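(* Let $f,g\in\mathbb{Z}[x]$ be monic irreducible polynomials of coprime degrees, let $\alpha,\beta\in\mathbb{C}$ be roots of $f$ and $g$ respectively, and suppose that $\mathbb{Q}(\alpha)\cong\mathbb{Q}[x]/(f)$ and $\mathbb{Q}(\beta)\cong\mathbb{Q}[x]/(g)$ are normal extensions of $\mathbb{Q}$. If $(t,p)$ is a first-degree prime ideal of $\mathbb{Z}[\alpha+\beta]$, then it is a combination of first-degree prime ideals of $\mathbb{Z}[\alpha]$ and $\mathbb{Z}[\beta]$, i.e. there exist a first-degree prime ideal $(r,p)$ of $\mathbb{Z}[\alpha]$ and a first-degree prime ideal $(s,p)$ of $\mathbb{Z}[\beta]$ with $t=r+s$ in $\mathbb{F}_p$.
   Context: For an algebraic integer $\theta$, a first-degree prime ideal of $\mathbb{Z}[\theta]$ is a non-zero prime ideal $\mathfrak{p}$ of $\mathbb{Z}[\theta]$ whose norm $[\mathbb{Z}[\theta]:\mathfrak{p}]$ is a prime number. If $h\in\mathbb{Z}[x]$ is the (monic) minimal polynomial of $\theta$ over $\mathbb{Q}$, the first-degree prime ideals of $\mathbb{Z}[\theta]$ of norm $p$ are in bijection with the pairs $(t,p)$ with $t\in\mathbb{F}_p$ and $h(t)=0$ in $\mathbb{F}_p$; the pair $(t,p)$ denotes the kernel of the ring homomorphism $\mathbb{Z}[\theta]\to\mathbb{F}_p$, $\theta\mapsto t$. The combination of the first-degree prime ideals $(r,p)\subseteq\mathbb{Z}[\alpha]$ and $(s,p)\subseteq\mathbb{Z}[\beta]$ is the first-degree prime ideal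 $(r+s,p)\subseteq\mathbb{Z}[\alpha+\beta]$. *)

theory Defs
  imports
    "HOL-Algebra.Algebraic_Closure_Type"
    "HOL-Algebra.Generated_Rings"
    "HOL-Algebra.Generated_Fields"
    "HOL-Number_Theory.Residues"
    Complex_Main
begin

abbreviation complex_field :: "complex ring" where
  "complex_field \<equiv> ring_of_type_algebra"

definition int_adjoin :: "complex \<Rightarrow> complex ring" where
  "int_adjoin \<theta> = complex_field \<lparr>carrier := generate_ring complex_field {\<theta>}\<rparr>"

definition rat_adjoin :: "complex \<Rightarrow> complex set" where
  "rat_adjoin \<theta> = generate_field complex_field {\<theta>}"

definition splits_over :: "complex set \<Rightarrow> rat poly \<Rightarrow> bool" where
  "splits_over L q \<longleftrightarrow>
     (\<exists>c\<in>L. \<exists>xs. set xs \<subseteq> L \<and>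
        map_poly of_rat q = Polynomial.smult c (\<Prod>x\<leftarrow>xs. [:- x, 1:]))"

text \<open>Meant for subfields \<open>L\<close> of the complex numbers.\<close>

definition normal_over_rat :: "complex set \<Rightarrow> bool" where
  "normal_over_rat L \<longleftrightarrow>
     (\<forall>x\<in>L. algebraic x) \<and>
     (\<forall>q :: rat poly. Factorial_Ring.irreducible q \<longrightarrow>
        (\<exists>x\<in>L. poly (map_poly of_rat q) x = 0) \<longrightarrow> splits_over L q)"

text \<open>The index of the additive subgroup \<open>P\<close>; it is \<open>0\<close> if that index is infinite.\<close>

definition ideal_norm :: "complex \<Rightarrow> complex set \<Rightarrow> nat" where
  "ideal_norm \<theta> P = card (a_rcosets\<^bsub>int_adjoin \<theta>\<^esub> P)"

definition first_degree_prime_ideal :: "complex \<Rightarrow> complex set \<Rightarrow> bool" where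
  "first_degree_prime_ideal \<theta> P \<longleftrightarrow>
     primeideal P (int_adjoin \<theta>) \<and> P \<noteq> {0} \<and> Factorial_Ring.prime (ideal_norm \<theta> P)"

text \<open>
  The field with \<open>p\<close> elements is \<open>residue_ring (int p)\<close>, whose elements are the integers
  from \<open>0\<close> to \<open>p - 1\<close>.  As \<open>\<theta>\<close> generates the ring, there is at most one homomorphism
  sending \<open>\<theta>\<close> to \<open>t\<close>, so the pair \<open>(t, p)\<close> denotes at most one ideal.
\<close>

definition pair_denotes :: "complex \<Rightarrow> int \<Rightarrow> nat \<Rightarrow> complex set \<Rightarrow> bool" where
  "pair_denotes \<theta> t p P \<longleftrightarrow>
     (\<exists>\<phi> \<in> ring_hom (int_adjoin \<theta>) (residue_ring (int p)).
        \<phi> \<theta> = t \<and> P = a_kernel (int_adjoin \<theta>) (residue_ring (int p)) \<phi>)"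

definition first_degree_prime_pair :: "complex \<Rightarrow> int \<Rightarrow> nat \<Rightarrow> bool" where
  "first_degree_prime_pair \<theta> t p \<longleftrightarrow>
     (\<exists>P. first_degree_prime_ideal \<theta> P \<and> ideal_norm \<theta> P = p \<and> pair_denotes \<theta> t p P)"

end

theory Submission
  imports
    Defs
    "Jordan_Normal_Form.Char_Poly"
    "Berlekamp_Zassenhaus.Square_Free_Int_To_Square_Free_GFp"
begin

text \<open>
  The ideal \<open>(t, p)\<close> lies under a prime ideal \<open>M\<close> of the ring of all algebraic integers, so that
  \<open>\<alpha> + \<beta> \<equiv> t\<close> modulo \<open>M\<close>.  Let \<open>G\<close> be the Galois group of \<open>\<rat>(\<alpha>)\<close>, of order \<open>m = deg f\<close>.
  Comparing the reductions modulo \<open>M\<close> of \<open>\<Prod>\<^sub>\<sigma> (X - \<Sum>\<^sub>i \<sigma>(\<alpha>\<^sub>i) T\<^sup>i)\<close>, whose coefficients are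
  integers, before and after applying the Frobenius map, unique factorization yields some \<open>\<sigma>\<close> in
  \<open>G\<close> with \<open>\<alpha>\<^sub>i\<^sup>p \<equiv> \<sigma>(\<alpha>\<^sub>i)\<close> for all conjugates \<open>\<alpha>\<^sub>i\<close> simultaneously.  Iterating \<open>m\<close> times shows that
  \<open>\<alpha>\<close> is fixed by the \<open>m\<close>-th power of Frobenius modulo \<open>M\<close>, and likewise \<open>\<beta>\<close> by the \<open>n\<close>-th
  power, where \<open>n = deg g\<close>.  As \<open>\<beta> \<equiv> t - \<alpha>\<close>, both powers fix \<open>\<beta>\<close>, hence so does Frobenius itself
  because \<open>m\<close> and \<open>n\<close> are coprime.  Thus \<open>\<beta>\<close>, and with it \<open>\<alpha>\<close>, is congruent to an integer modulo \<open>M\<close>.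
\<close>

section \<open>Algebraic integers form a ring\<close>

text \<open>The number \<open>z\<close> is an eigenvalue of an integer matrix, hence a root of its
  characteristic polynomial, which is monic with integer coefficients.\<close>

lemma algebraic_int_if_int_eigenvector:
  fixes v :: "nat \<Rightarrow> complex" and A :: "nat \<Rightarrow> nat \<Rightarrow> int"
  assumes "k < n" "v k \<noteq> 0"
    and ev: "\<And>i. i < n \<Longrightarrow> z * v i = (\<Sum>j<n. of_int (A i j) * v j)"
  shows "algebraic_int z"
proof -
  define B where "B = mat n n (\<lambda>(i, j). A i j)"
  have B: "B \<in> carrier_mat n n"
    by (simp add: B_def)
  define C where "C = map_mat (of_int :: int \<Rightarrow> complex) B"
  have C: "C \<in> carrier_mat n n"
    by (simp add: C_def B)
  have "eigenvector C (vec n v) z"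
    unfolding eigenvector_def
  proof (intro conjI)
    show "vec n v \<in> carrier_vec (dim_row C)"
      using C by auto
    show "vec n v \<noteq> 0\<^sub>v (dim_row C)"
      using C assms(1,2) by (metis carrier_matD(1) index_vec index_zero_vec(1))
    show "C *\<^sub>v vec n v = z \<cdot>\<^sub>v vec n v"
      by (rule eq_vecI) (auto simp: C_def B_def ev scalar_prod_def atLeast0LessThan)
  qed
  hence "eigenvalue C z"
    by (auto simp: eigenvalue_def)
  hence "poly (char_poly C) z = 0"
    using eigenvalue_root_char_poly[OF C] by simp
  hence "poly (map_poly of_int (char_poly B)) z = 0"
    using of_int_hom.char_poly_hom[OF B, where ?'a = complex] by (simp add: C_def)
  moreover have "lead_coeff (char_poly B) = 1"
    using degree_monic_char_poly[OF B] by simp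
  ultimately show ?thesis
    by (auto simp: algebraic_int_altdef_ipoly)
qed

abbreviation int_span :: "complex set \<Rightarrow> complex set" where
  "int_span \<equiv> Modules.module.span (\<lambda>(c :: int) x. of_int c * x)"

interpretation int_span: Modules.module "\<lambda>(c :: int) (x :: complex). of_int c * x"
  by unfold_locales (auto simp: algebra_simps)

lemma int_span_mult_stable:
  assumes "\<And>s. s \<in> S \<Longrightarrow> x * s \<in> int_span S" "y \<in> int_span S"
  shows "x * y \<in> int_span S"
  using assms(2)
proof (induction rule: int_span.span_induct_alt)
  case base
  show ?case by (simp add: int_span.span_zero)
next
  case (step c s y)
  have "x * (of_int c * s + y) = of_int c * (x * s) + x * y"
    by (simp add: algebra_simps)
  with step assms(1) show ?case
    by (auto intro!: int_span.span_add int_span.span_scale)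
qed

text \<open>Multiplication by \<open>z\<close> is described on the generators by an integer matrix
  with the vector of generators as eigenvector; \<open>s\<close> makes this vector nonzero.\<close>

lemma algebraic_int_if_stabilizes_int_span:
  assumes "finite S" "s \<in> S" "s \<noteq> 0" and stable: "\<And>s. s \<in> S \<Longrightarrow> z * s \<in> int_span S"
  shows "algebraic_int z"
proof -
  obtain v where v: "bij_betw v {0..<card S} S"
    using ex_bij_betw_nat_finite[OF assms(1)] by blast
  have "\<exists>c. z * v i = (\<Sum>j<card S. of_int (c j) * v j)" if "i < card S" for i
  proof -
    have "v i \<in> S"
      using v that by (auto simp: bij_betw_def)
    from stable[OF this] obtain c where "z * v i = (\<Sum>s\<in>S. of_int (c s) * s)"
      unfolding int_span.span_finite[OF assms(1)] by auto
    also have "\<dots> = (\<Sum>j<card S. of_int (c (v j)) * v j)"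
      using v by (intro sum.reindex_bij_betw[symmetric]) (simp add: atLeast0LessThan)
    finally show ?thesis by (intro exI[of _ "\<lambda>j. c (v j)"])
  qed
  then obtain A where A: "\<And>i. i < card S \<Longrightarrow> z * v i = (\<Sum>j<card S. of_int (A i j) * v j)"
    by metis
  obtain k where "k < card S" "v k = s"
    using v assms(2) unfolding bij_betw_def by (metis atLeastLessThan_iff imageE)
  with A assms(3) show ?thesis
    by (intro algebraic_int_if_int_eigenvector[of k "card S" v z A]) auto
qed

text \<open>The products \<open>x ^ i * y ^ j\<close> with exponents below the degrees of
  \<open>P\<close> and \<open>Q\<close> span a module stable under multiplication by
  \<open>x\<close> and by \<open>y\<close>, hence by their sum and product.\<close>

lemma
  fixes x y :: complex
  assumes x: "algebraic_int x" and y: "algebraic_int y"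
  shows algebraic_int_add: "algebraic_int (x + y)"
    and algebraic_int_times: "algebraic_int (x * y)"
proof -
  obtain P where P: "poly (map_poly of_int P) x = 0" "lead_coeff P = 1"
    using x by (auto simp: algebraic_int_altdef_ipoly)
  obtain Q where Q: "poly (map_poly of_int Q) y = 0" "lead_coeff Q = 1"
    using y by (auto simp: algebraic_int_altdef_ipoly)
  define m where "m = Polynomial.degree P"
  define n where "n = Polynomial.degree Q"
  have "m > 0" "n > 0"
    using P Q by (auto simp: m_def n_def intro!: Nat.gr0I elim!: degree_eq_zeroE)
  define S where "S = (\<lambda>(i, j). x ^ i * y ^ j) ` ({..<m} \<times> {..<n})"
  \<comment> \<open>The monic equation rewrites the first power that leaves the exponent range in
    terms of lower ones.\<close>
  have top: "z ^ Polynomial.degree R = - (\<Sum>i<Polynomial.degree R. of_int (coeff R i) * z ^ i)"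
    if "poly (map_poly of_int R) z = 0" "lead_coeff R = 1" for R and z :: complex
  proof -
    have "(\<Sum>i\<le>Polynomial.degree R. of_int (coeff R i) * z ^ i) = 0"
      using that by (simp add: poly_altdef degree_map_poly coeff_map_poly)
    thus ?thesis
      using that(2) by (simp flip: lessThan_Suc_atMost add: add_eq_0_iff)
  qed
  have S: "x ^ i * y ^ j \<in> int_span S" if "i < m" "j < n" for i j
    using that by (intro int_span.span_base) (auto simp: S_def)
  have xS: "x * s \<in> int_span S" if "s \<in> S" for s
  proof -
    obtain i j where ij: "i < m" "j < n" "s = x ^ i * y ^ j"
      using \<open>s \<in> S\<close> by (auto simp: S_def)
    show ?thesis
    proof (cases "Suc i = m")
      case True
      have "x * s = x ^ m * y ^ j"
        by (simp add: ij flip: True)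
      also have "\<dots> = - (\<Sum>i<m. of_int (coeff P i) * (x ^ i * y ^ j))"
        using top[OF P] by (simp add: m_def sum_distrib_right mult.assoc)
      finally show ?thesis
        using ij by (auto intro!: int_span.span_neg int_span.span_sum int_span.span_scale S)
    next
      case False
      thus ?thesis using S[of "Suc i" j] ij by (simp add: mult_ac)
    qed
  qed
  have yS: "y * s \<in> int_span S" if "s \<in> S" for s
  proof -
    obtain i j where ij: "i < m" "j < n" "s = x ^ i * y ^ j"
      using \<open>s \<in> S\<close> by (auto simp: S_def)
    show ?thesis
    proof (cases "Suc j = n")
      case True
      have "y * s = x ^ i * y ^ n"
        by (simp add: ij flip: True)
      also have "\<dots> = - (\<Sum>j<n. of_int (coeff Q j) * (x ^ i * y ^ j))"
        using top[OF Q] by (simp add: n_def sum_distrib_left mult.left_commute)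
      finally show ?thesis
        using ij by (auto intro!: int_span.span_neg int_span.span_sum int_span.span_scale S)
    next
      case False
      thus ?thesis using S[of i "Suc j"] ij by (simp add: mult_ac)
    qed
  qed
  have 1: "finite S" "1 \<in> S"
    using \<open>m > 0\<close> \<open>n > 0\<close>
    by (auto simp: S_def intro!: rev_image_eqI[of "(0, 0)"])
  show "algebraic_int (x + y)"
    using xS yS by (intro algebraic_int_if_stabilizes_int_span[OF 1])
      (auto simp: distrib_right intro!: int_span.span_add)
  show "algebraic_int (x * y)"
  proof (rule algebraic_int_if_stabilizes_int_span[OF 1])
    show "x * y * s \<in> int_span S" if "s \<in> S" for s
      using int_span_mult_stable[OF xS yS[OF that]] by (simp add: mult_ac)
  qed auto
qed

lemma algebraic_int_diff:
  fixes x y :: complex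
  assumes "algebraic_int x" "algebraic_int y"
  shows "algebraic_int (x - y)"
  using algebraic_int_add[OF assms(1) algebraic_int_minus[OF assms(2)]] by simp

lemma algebraic_int_sum:
  fixes f :: "'a \<Rightarrow> complex"
  assumes "\<And>i. i \<in> I \<Longrightarrow> algebraic_int (f i)"
  shows "algebraic_int (sum f I)"
  using assms by (induction I rule: infinite_finite_induct) (auto intro: algebraic_int_add)

lemma algebraic_int_power:
  fixes x :: complex
  assumes "algebraic_int x"
  shows "algebraic_int (x ^ n)"
  using assms by (induction n) (auto intro: algebraic_int_times)

lemma algebraic_int_poly_of_int:
  fixes x :: complex
  assumes "algebraic_int x"
  shows "algebraic_int (poly (map_poly of_int P) x)"
  by (auto simp: poly_altdef coeff_map_poly intro!: algebraic_int_sum algebraic_int_times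
      algebraic_int_power assms)

section \<open>Prime ideals of the ring of algebraic integers\<close>

text \<open>Ideals of the ring of all algebraic integers, as plain sets of complex numbers.
  Arithmetic in a quotient is expressed by differences lying in the ideal.\<close>

definition alg_int_ideal :: "complex set \<Rightarrow> bool" where
  "alg_int_ideal J \<longleftrightarrow> (\<forall>x\<in>J. algebraic_int x) \<and> 0 \<in> J \<and> (\<forall>x\<in>J. \<forall>y\<in>J. x + y \<in> J) \<and>
     (\<forall>x\<in>J. \<forall>r. algebraic_int r \<longrightarrow> r * x \<in> J)"

locale alg_int_prime =
  fixes M :: "complex set"
  assumes ideal: "alg_int_ideal M"
    and one_notin: "1 \<notin> M"
    and prime: "\<lbrakk>algebraic_int x; algebraic_int y; x * y \<in> M\<rbrakk> \<Longrightarrow> x \<in> M \<or> y \<in> M"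

lemma alg_int_ideal_Union_chain:
  assumes "C \<noteq> {}" "subset.chain {J. alg_int_ideal J} C"
  shows "alg_int_ideal (\<Union>C)"
proof -
  have C: "alg_int_ideal J" if "J \<in> C" for J
    using assms(2) that by (auto simp: subset.chain_def)
  have "x + y \<in> \<Union>C" if "J \<in> C" "J' \<in> C" "x \<in> J" "y \<in> J'" for x y J J'
  proof -
    have "J \<subseteq> J' \<or> J' \<subseteq> J"
      using assms(2) that by (auto simp: subset.chain_def)
    thus ?thesis
      using C that unfolding alg_int_ideal_def by blast
  qed
  thus ?thesis
    using C assms(1) unfolding alg_int_ideal_def by blast
qed

lemma alg_int_ideal_adjoin:
  assumes "alg_int_ideal J" "algebraic_int x"
  shows "alg_int_ideal {a + r * x |a r. a \<in> J \<and> algebraic_int r}"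
  unfolding alg_int_ideal_def
proof (intro conjI ballI allI impI)
  show "0 \<in> {a + r * x |a r. a \<in> J \<and> algebraic_int r}"
    using assms(1) by (auto simp: alg_int_ideal_def intro!: exI[of _ 0])
next
  fix y assume "y \<in> {a + r * x |a r. a \<in> J \<and> algebraic_int r}"
  thus "algebraic_int y"
    using assms by (auto simp: alg_int_ideal_def intro!: algebraic_int_add algebraic_int_times)
next
  fix y z
  assume "y \<in> {a + r * x |a r. a \<in> J \<and> algebraic_int r}" "z \<in> {a + r * x |a r. a \<in> J \<and> algebraic_int r}"
  then obtain a r b s where *: "y = a + r * x" "z = b + s * x" "a \<in> J" "b \<in> J"
    "algebraic_int r" "algebraic_int s"
    by blast
  have "y + z = (a + b) + (r + s) * x"
    by (simp add: * algebra_simps)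
  moreover have "a + b \<in> J" "algebraic_int (r + s)"
    using * assms(1) by (auto simp: alg_int_ideal_def intro: algebraic_int_add)
  ultimately show "y + z \<in> {a + r * x |a r. a \<in> J \<and> algebraic_int r}"
    by blast
next
  fix y c :: complex
  assume "y \<in> {a + r * x |a r. a \<in> J \<and> algebraic_int r}" and c: "algebraic_int c"
  then obtain a r where *: "y = a + r * x" "a \<in> J" "algebraic_int r"
    by blast
  have "c * y = c * a + (c * r) * x"
    by (simp add: * algebra_simps)
  moreover have "c * a \<in> J" "algebraic_int (c * r)"
    using * assms(1) c by (auto simp: alg_int_ideal_def intro: algebraic_int_times)
  ultimately show "c * y \<in> {a + r * x |a r. a \<in> J \<and> algebraic_int r}"
    by blast
qed

text \<open>By Zorn's lemma there is an ideal maximal among those containing \<open>I\<close> and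
  avoiding 1; such an ideal is prime.\<close>

lemma ex_alg_int_prime_above:
  assumes "alg_int_ideal I" "1 \<notin> I"
  obtains M where "alg_int_prime M" "I \<subseteq> M"
proof -
  define A where "A = {J. alg_int_ideal J \<and> I \<subseteq> J \<and> 1 \<notin> J}"
  have "\<exists>M\<in>A. \<forall>J\<in>A. M \<subseteq> J \<longrightarrow> J = M"
  proof (rule subset_Zorn_nonempty)
    show "A \<noteq> {}"
      using assms by (auto simp: A_def)
  next
    fix C assume C: "C \<noteq> {}" "subset.chain A C"
    have "subset.chain {J. alg_int_ideal J} C"
      using C(2) by (auto simp: subset.chain_def A_def)
    hence "alg_int_ideal (\<Union>C)"
      using C(1) by (intro alg_int_ideal_Union_chain)
    thus "\<Union>C \<in> A"
      using C by (auto simp: A_def subset.chain_def)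
  qed
  then obtain M where "M \<in> A" and max: "\<And>J. \<lbrakk>J \<in> A; M \<subseteq> J\<rbrakk> \<Longrightarrow> J = M"
    by blast
  hence M: "alg_int_ideal M" "I \<subseteq> M" "1 \<notin> M"
    by (simp_all add: A_def)
  have "x \<in> M \<or> y \<in> M" if x: "algebraic_int x" and y: "algebraic_int y" and "x * y \<in> M" for x y
  proof (rule disjCI)
    assume "y \<notin> M"
    \<comment> \<open>By maximality the ideal generated by \<open>M\<close> and \<open>y\<close>
      contains 1. Multiplying the resulting equation by \<open>x\<close> puts \<open>x\<close> into
      \<open>M\<close>.\<close>
    define J where "J = {a + r * y |a r. a \<in> M \<and> algebraic_int r}"
    have "M \<subseteq> J"
      unfolding J_def by (intro subsetI CollectI exI[of _ _] exI[of _ 0]) auto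
    moreover have "y \<in> J"
      using M(1) unfolding J_def
      by (intro CollectI exI[of _ 0] exI[of _ 1]) (auto simp: alg_int_ideal_def)
    moreover have "alg_int_ideal J"
      unfolding J_def by (rule alg_int_ideal_adjoin[OF M(1) y])
    ultimately have "1 \<in> J"
      using max[of J] M(2) \<open>y \<notin> M\<close> by (auto simp: A_def)
    then obtain a r where ar: "1 = a + r * y" "a \<in> M" "algebraic_int r"
      unfolding J_def by blast
    have "x = x * (a + r * y)"
      by (simp flip: ar(1))
    also have "\<dots> = x * a + r * (x * y)"
      by (simp add: algebra_simps)
    also have "\<dots> \<in> M"
      using M(1) ar x that(3) unfolding alg_int_ideal_def by blast
    finally show "x \<in> M" .
  qed
  with M show ?thesis
    by (intro that[of M]) (auto simp: alg_int_prime_def)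
qed

lemma poly_map_poly_of_int_sum_monom:
  "poly (map_poly of_int (\<Sum>i\<in>I. Polynomial.monom (c i) (e i))) (x :: complex) =
     (\<Sum>i\<in>I. of_int (c i) * x ^ e i)"
  by (simp add: of_int_poly_hom.hom_sum poly_sum poly_monom)

text \<open>
  Lying over without module theory: if \<open>1 = p u + \<gamma> v\<close>, then multiplying an integral
  equation of degree \<open>n\<close> of \<open>v\<close> by \<open>\<gamma>\<^sup>n\<close> yields an integer polynomial \<open>E\<close> with \<open>E(0) = 1\<close> for
  which \<open>E(\<gamma>) / p\<close> is again integral; an integral equation of the latter contradicts \<open>dvd\<close>.
\<close>

lemma one_notin_ideal_generated:
  fixes \<gamma> u v :: complex and p :: nat
  assumes "p > 1" and \<gamma>: "algebraic_int \<gamma>" and u: "algebraic_int u" and v: "algebraic_int v"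
    and dvd: "\<And>P :: int poly. poly (map_poly of_int P) \<gamma> = 0 \<Longrightarrow> int p dvd poly P 0"
  shows "1 \<noteq> of_nat p * u + \<gamma> * v"
proof
  assume 1: "1 = of_nat p * u + \<gamma> * v"
  obtain V where V: "poly (map_poly of_int V) v = 0" "lead_coeff V = 1"
    using v by (auto simp: algebraic_int_altdef_ipoly)
  define n where "n = Polynomial.degree V"
  \<comment> \<open>The reciprocal polynomial of \<open>V\<close>: its constant term is the leading
    coefficient of \<open>V\<close>.\<close>
  define E where "E = (\<Sum>i\<le>n. Polynomial.monom (coeff V i) (n - i))"
  define e where "e = poly (map_poly of_int E) \<gamma>"
  have e: "e = (\<Sum>i\<le>n. of_int (coeff V i) * \<gamma> ^ (n - i))"
    by (simp add: e_def E_def poly_map_poly_of_int_sum_monom)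
  have E0: "poly E 0 = 1"
  proof -
    have "poly E 0 = (\<Sum>i\<le>n. coeff V i * (if n - i = 0 then 1 else 0))"
      by (simp add: E_def poly_sum poly_monom power_0_left)
    also have "\<dots> = (\<Sum>i\<le>n. if i = n then coeff V i else 0)"
      by (intro sum.cong) auto
    also have "\<dots> = 1"
      using V by (simp add: n_def)
    finally show ?thesis .
  qed
  \<comment> \<open>The quotient of \<open>e\<close> by \<open>p\<close>: subtracting \<gamma>^n
    V(v) = 0 from \<open>e\<close> leaves factors 1 - (\<gamma> v)^i, which are multiples of 1 -
    \<gamma> v = p u.\<close>
  define w where "w = (\<Sum>i\<le>n. of_int (coeff V i) * \<gamma> ^ (n - i) * (u * (\<Sum>j<i. (\<gamma> * v) ^ j)))"
  have w: "algebraic_int w"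
    unfolding w_def
    by (intro algebraic_int_sum algebraic_int_times algebraic_int_power \<gamma> u v algebraic_int_of_int)
  have "e = of_nat p * w"
  proof -
    have "0 = \<gamma> ^ n * poly (map_poly of_int V) v"
      using V by simp
    also have "\<dots> = (\<Sum>i\<le>n. of_int (coeff V i) * (\<gamma> ^ n * v ^ i))"
      by (simp add: poly_altdef n_def degree_map_poly coeff_map_poly sum_distrib_left mult_ac)
    also have "\<dots> = (\<Sum>i\<le>n. of_int (coeff V i) * \<gamma> ^ (n - i) * (\<gamma> * v) ^ i)"
      by (intro sum.cong) (auto simp: power_mult_distrib simp flip: power_add)
    finally have "e = (\<Sum>i\<le>n. of_int (coeff V i) * \<gamma> ^ (n - i) * (1 - (\<gamma> * v) ^ i))"
      by (simp add: e right_diff_distrib sum_subtractf)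
    also have "\<dots> = (\<Sum>i\<le>n. of_int (coeff V i) * \<gamma> ^ (n - i) * (of_nat p * (u * (\<Sum>j<i. (\<gamma> * v) ^ j))))"
    proof (intro sum.cong refl arg_cong[of _ _ "(*) _"])
      fix i
      have "1 - \<gamma> * v = of_nat p * u"
        unfolding 1 by simp
      thus "1 - (\<gamma> * v) ^ i = of_nat p * (u * (\<Sum>j<i. (\<gamma> * v) ^ j))"
        by (simp add: one_diff_power_eq)
    qed
    also have "\<dots> = of_nat p * w"
      by (simp add: w_def sum_distrib_left mult_ac)
    finally show ?thesis .
  qed
  obtain U where U: "poly (map_poly of_int U) w = 0" "lead_coeff U = 1"
    using w by (auto simp: algebraic_int_altdef_ipoly)
  define k where "k = Polynomial.degree U"
  \<comment> \<open>This is p^k U(X/p), monic and vanishing at \<open>e\<close>. Composed with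
    \<open>E\<close> it vanishes at \<gamma>, while its value at E(0) = 1 is 1 modulo
    \<open>p\<close>.\<close>
  define U' where "U' = (\<Sum>i\<le>k. Polynomial.monom (coeff U i * int p ^ (k - i)) i)"
  have "poly (map_poly of_int U') e = (\<Sum>i\<le>k. of_int (coeff U i * int p ^ (k - i)) * e ^ i)"
    by (simp only: U'_def poly_map_poly_of_int_sum_monom)
  also have "\<dots> = (\<Sum>i\<le>k. of_nat p ^ k * (of_int (coeff U i) * w ^ i))"
    by (intro sum.cong) (auto simp: \<open>e = of_nat p * w\<close> power_mult_distrib simp flip: power_add)
  also have "\<dots> = of_nat p ^ k * poly (map_poly of_int U) w"
    by (simp add: poly_altdef k_def degree_map_poly coeff_map_poly sum_distrib_left)
  finally have "poly (map_poly of_int U') e = 0"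
    using U by simp
  hence "poly (map_poly of_int (U' \<circ>\<^sub>p E)) \<gamma> = 0"
    by (simp add: e_def of_int_hom.map_poly_pcompose poly_pcompose)
  hence "int p dvd poly U' 1"
    using dvd[of "U' \<circ>\<^sub>p E"] by (simp add: poly_pcompose E0)
  moreover have "poly U' 1 = 1 + (\<Sum>i<k. coeff U i * int p ^ (k - i))"
    using U by (simp add: U'_def poly_sum poly_monom k_def flip: lessThan_Suc_atMost)
  moreover have "int p dvd (\<Sum>i<k. coeff U i * int p ^ (k - i))"
    by (intro dvd_sum) (auto intro!: dvd_mult dvd_power)
  ultimately have "int p dvd 1"
    by (metis dvd_add_left_iff)
  thus False
    using \<open>p > 1\<close> by simp
qed

text \<open>The divisibility hypothesis makes \<gamma> \<mapsto> 0 a well-defined homomorphism from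
  \<int>[\<gamma>] to the field with \<open>p\<close> elements. The ideal generated by
  \<open>p\<close> and \<gamma> is then proper and lies in a prime.\<close>

lemma ex_alg_int_prime_lying_over:
  fixes \<gamma> :: complex and p :: nat
  assumes "p > 1" and \<gamma>: "algebraic_int \<gamma>"
    and dvd: "\<And>P :: int poly. poly (map_poly of_int P) \<gamma> = 0 \<Longrightarrow> int p dvd poly P 0"
  obtains M where "alg_int_prime M" "of_nat p \<in> M" "\<gamma> \<in> M"
proof -
  have "alg_int_ideal {0}"
    by (simp add: alg_int_ideal_def)
  from alg_int_ideal_adjoin[OF this algebraic_int_of_nat]
  have "alg_int_ideal {a + r * of_nat p |a r. a \<in> {0} \<and> algebraic_int r}" .
  from alg_int_ideal_adjoin[OF this \<gamma>]
  have I: "alg_int_ideal {r * of_nat p + s * \<gamma> |r s. algebraic_int r \<and> algebraic_int s}" (is "alg_int_ideal ?I")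
    by (rule back_subst[of alg_int_ideal]) auto
  have "1 \<notin> ?I"
    using one_notin_ideal_generated[OF assms(1) \<gamma> _ _ dvd] by (auto simp: mult_ac)
  then obtain M where M: "alg_int_prime M" "?I \<subseteq> M"
    using ex_alg_int_prime_above[OF I] by blast
  have "of_nat p \<in> ?I" 
    by (intro CollectI exI[of _ 1] exI[of _ 0]) auto
  moreover have "\<gamma> \<in> ?I"
    by (intro CollectI exI[of _ 0] exI[of _ 1]) auto
  ultimately show ?thesis
    using M that by blast
qed

section \<open>Frobenius and conjugates modulo a prime\<close>

text \<open>A relational form of ring homomorphisms. It covers both Frobenius modulo
  \<open>M\<close> and the Galois automorphisms, neither of which is given as a function on all
  complex numbers. The clause for -1 supplies negation through multiplication.\<close>

definition ring_rel :: "('a :: comm_ring_1 \<Rightarrow> 'b :: comm_ring_1 \<Rightarrow> bool) \<Rightarrow> bool" where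
  "ring_rel R \<longleftrightarrow> R 0 0 \<and> R 1 1 \<and> R (-1) (-1) \<and>
     (\<forall>x y x' y'. R x y \<longrightarrow> R x' y' \<longrightarrow> R (x + x') (y + y') \<and> R (x * x') (y * y'))"

definition coeff_rel :: "('a :: comm_ring_1 \<Rightarrow> 'b :: comm_ring_1 \<Rightarrow> bool) \<Rightarrow> 'a poly \<Rightarrow> 'b poly \<Rightarrow> bool" where
  "coeff_rel R P Q \<longleftrightarrow> (\<forall>i. R (coeff P i) (coeff Q i))"

lemma ring_relI:
  assumes "R 0 0" "R 1 1" "R (-1) (-1)"
    and "\<And>x y x' y'. R x y \<Longrightarrow> R x' y' \<Longrightarrow> R (x + x') (y + y')"
    and "\<And>x y x' y'. R x y \<Longrightarrow> R x' y' \<Longrightarrow> R (x * x') (y * y')"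
  shows "ring_rel R"
  using assms by (simp add: ring_rel_def)

lemma
  assumes "ring_rel R"
  shows ring_rel_zero: "R 0 0" and ring_rel_one: "R 1 1"
    and ring_rel_add: "R x y \<Longrightarrow> R x' y' \<Longrightarrow> R (x + x') (y + y')"
    and ring_rel_mult: "R x y \<Longrightarrow> R x' y' \<Longrightarrow> R (x * x') (y * y')"
    and ring_rel_uminus: "R x y \<Longrightarrow> R (- x) (- y)"
proof -
  show "R 0 0" "R 1 1" and add: "R x y \<Longrightarrow> R x' y' \<Longrightarrow> R (x + x') (y + y')"
    and mult: "R x y \<Longrightarrow> R x' y' \<Longrightarrow> R (x * x') (y * y')" for x y x' y'
    using assms by (simp_all add: ring_rel_def)
  have "R (-1) (-1)"
    using assms by (simp add: ring_rel_def)
  from mult[OF this, of x y] show "R x y \<Longrightarrow> R (- x) (- y)"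
    by simp
qed

lemma ring_rel_sum:
  assumes "ring_rel R" "\<And>i. i \<in> I \<Longrightarrow> R (f i) (g i)"
  shows "R (sum f I) (sum g I)"
  using assms(2)
  by (induction I rule: infinite_finite_induct)
     (simp_all add: ring_rel_zero[OF assms(1)] ring_rel_add[OF assms(1)])

lemma ring_rel_prod:
  assumes "ring_rel R" "\<And>i. i \<in> I \<Longrightarrow> R (f i) (g i)"
  shows "R (prod f I) (prod g I)"
  using assms(2)
  by (induction I rule: infinite_finite_induct)
     (simp_all add: ring_rel_one[OF assms(1)] ring_rel_mult[OF assms(1)])

lemma coeff_rel_pCons:
  assumes "R a b" "coeff_rel R P Q"
  shows "coeff_rel R (pCons a P) (pCons b Q)"
  using assms by (simp add: coeff_rel_def coeff_pCons split: nat.splits)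

lemma ring_rel_coeff_rel:
  fixes R :: "'a :: comm_ring_1 \<Rightarrow> 'b :: comm_ring_1 \<Rightarrow> bool"
  assumes R: "ring_rel R"
  shows "ring_rel (coeff_rel R)"
proof (rule ring_relI)
  show 0: "coeff_rel R 0 0"
    by (simp add: coeff_rel_def ring_rel_zero[OF R])
  show 1: "coeff_rel R 1 1"
    unfolding one_pCons by (rule coeff_rel_pCons[OF ring_rel_one[OF R] 0])
  show "coeff_rel R (-1) (-1)"
    using 1 by (simp add: coeff_rel_def ring_rel_uminus[OF R])
next
  fix P Q P' Q' assume *: "coeff_rel R P Q" "coeff_rel R P' Q'"
  show "coeff_rel R (P + P') (Q + Q')"
    using * by (simp add: coeff_rel_def ring_rel_add[OF R])
  show "coeff_rel R (P * P') (Q * Q')"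
    using * unfolding coeff_rel_def coeff_mult
    by (intro allI ring_rel_sum[OF R] ring_rel_mult[OF R]) auto
qed

text \<open>Used with \<open>R\<close> itself of the form \<open>coeff_rel\<close>, it transfers
  products of X - u(T) with polynomial entries \<open>u\<close> from one side of a relation to the
  other.\<close>

lemma ring_rel_prod_linear:
  assumes R: "ring_rel R" and "\<And>a. a \<in> A \<Longrightarrow> R (u a) (v a)"
  shows "coeff_rel R (\<Prod>a\<in>A. [:- u a, 1:]) (\<Prod>a\<in>A. [:- v a, 1:])"
proof (rule ring_rel_prod[where R = "coeff_rel R", OF ring_rel_coeff_rel[OF R]])
  fix a assume "a \<in> A"
  have "coeff_rel R [:1:] [:1:]"
    using ring_rel_one[OF ring_rel_coeff_rel[OF R]] unfolding one_pCons .
  thus "coeff_rel R [:- u a, 1:] [:- v a, 1:]"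
    by (rule coeff_rel_pCons[where R = R, OF ring_rel_uminus[OF R assms(2)[OF \<open>a \<in> A\<close>]]])
qed

section \<open>Polynomials modulo a prime ideal\<close>

context alg_int_prime
begin

lemma zero: "0 \<in> M"
  and add: "x \<in> M \<Longrightarrow> y \<in> M \<Longrightarrow> x + y \<in> M"
  and mult_left: "x \<in> M \<Longrightarrow> algebraic_int r \<Longrightarrow> r * x \<in> M"
  using ideal by (auto simp: alg_int_ideal_def)

lemma mult_right: "x \<in> M \<Longrightarrow> algebraic_int r \<Longrightarrow> x * r \<in> M"
  using mult_left[of x r] by (subst mult.commute)

lemma uminus: "x \<in> M \<Longrightarrow> - x \<in> M"
  using mult_left[of x "-1"] by auto

lemma diff: "x \<in> M \<Longrightarrow> y \<in> M \<Longrightarrow> x - y \<in> M"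
  using add[of x "- y"] uminus by simp

lemma sum: "(\<And>i. i \<in> I \<Longrightarrow> f i \<in> M) \<Longrightarrow> sum f I \<in> M"
  by (induction I rule: infinite_finite_induct) (auto intro: add zero)

text \<open>Gauss's argument: if \<open>i\<close> and \<open>j\<close> are the least indices of
  coefficients outside \<open>M\<close>, the coefficient of the product at \<open>i + j\<close> is
  congruent to \<open>coeff P i * coeff Q j\<close>, which is outside \<open>M\<close>.\<close>

lemma coeffs_mult_in_prime:
  assumes P: "\<And>i. algebraic_int (coeff P i)" and Q: "\<And>i. algebraic_int (coeff Q i)"
    and PQ: "\<And>i. coeff (P * Q) i \<in> M"
  shows "(\<forall>i. coeff P i \<in> M) \<or> (\<forall>i. coeff Q i \<in> M)"
proof (rule ccontr)
  assume "\<not> ?thesis"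
  hence ex: "\<exists>i. coeff P i \<notin> M" "\<exists>i. coeff Q i \<notin> M"
    by auto
  define i where "i = (LEAST i. coeff P i \<notin> M)"
  define j where "j = (LEAST i. coeff Q i \<notin> M)"
  have i: "coeff P i \<notin> M" "\<And>k. k < i \<Longrightarrow> coeff P k \<in> M"
    using LeastI_ex[OF ex(1)] not_less_Least unfolding i_def by blast+
  have j: "coeff Q j \<notin> M" "\<And>k. k < j \<Longrightarrow> coeff Q k \<in> M"
    using LeastI_ex[OF ex(2)] not_less_Least unfolding j_def by blast+
  have "coeff P k * coeff Q (i + j - k) \<in> M" if "k \<in> {..i+j} - {i}" for k
  proof (cases "k < i")
    case True
    thus ?thesis using i(2) Q by (intro mult_right)
  next
    case False
    hence "i + j - k < j"
      using that by auto
    thus ?thesis using j(2) P by (intro mult_left)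
  qed
  hence "(\<Sum>k\<in>{..i+j} - {i}. coeff P k * coeff Q (i + j - k)) \<in> M"
    by (rule sum)
  moreover have "coeff (P * Q) (i + j) =
      coeff P i * coeff Q j + (\<Sum>k\<in>{..i+j} - {i}. coeff P k * coeff Q (i + j - k))"
    unfolding coeff_mult by (subst sum.remove[of _ i]) auto
  ultimately have "coeff P i * coeff Q j \<in> M"
    using diff[OF PQ[of "i + j"]] by fastforce
  thus False
    using prime P Q i(1) j(1) by blast
qed

lemma coeffs_algebraic_int_times:
  fixes P Q :: "complex poly"
  assumes "\<And>i. algebraic_int (coeff P i)" "\<And>i. algebraic_int (coeff Q i)"
  shows "algebraic_int (coeff (P * Q) i)"
  unfolding coeff_mult by (intro algebraic_int_sum algebraic_int_times assms)

lemma coeffs_algebraic_int_prod: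
  fixes P :: "'a \<Rightarrow> complex poly"
  assumes "\<And>a i. a \<in> A \<Longrightarrow> algebraic_int (coeff (P a) i)"
  shows "algebraic_int (coeff (\<Prod>a\<in>A. P a) i)"
  using assms
  by (induction A arbitrary: i rule: infinite_finite_induct)
     (auto simp: coeffs_algebraic_int_times coeff_1)

lemma coeffs_prod_in_prime:
  assumes "finite A" and "\<And>a i. a \<in> A \<Longrightarrow> algebraic_int (coeff (P a) i)"
    and "\<And>i. coeff (\<Prod>a\<in>A. P a) i \<in> M"
  shows "\<exists>a\<in>A. \<forall>i. coeff (P a) i \<in> M"
  using assms
proof (induction A rule: finite_induct)
  case empty
  from empty(2)[of 0] one_notin show ?case by simp
next
  case (insert a A)
  have "(\<forall>i. coeff (P a) i \<in> M) \<or> (\<forall>i. coeff (\<Prod>a\<in>A. P a) i \<in> M)"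
    using insert.prems insert.hyps
    by (intro coeffs_mult_in_prime coeffs_algebraic_int_prod) auto
  thus ?case
    using insert.IH insert.prems(1) by auto
qed

end

section \<open>The Frobenius map modulo a prime above \<open>p\<close>\<close>

locale alg_int_prime_over = alg_int_prime +
  fixes p :: nat
  assumes prime_p: "Factorial_Ring.prime p" and p_in: "of_nat p \<in> M"
begin

lemma of_int_in:
  assumes "int p dvd k"
  shows "of_int k \<in> M"
proof -
  from assms obtain c where "k = int p * c" ..
  thus ?thesis using mult_right[OF p_in, of "of_int c"] by simp
qed

text \<open>If \<open>M\<close> contained an integer prime to \<open>p\<close>, a Bezout identity
  would put 1 into \<open>M\<close>.\<close>

lemma of_int_in_iff: "of_int k \<in> M \<longleftrightarrow> int p dvd k"
proof
  assume k: "of_int k \<in> M"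
  show "int p dvd k"
  proof (rule ccontr)
    assume "\<not> int p dvd k"
    hence "Rings.coprime (int p) k"
      using prime_p by (simp add: prime_imp_coprime)
    then obtain a b where "a * int p + b * k = 1"
      by (metis bezout_int coprime_iff_gcd_eq_1)
    hence "of_int (a * int p + b * k) = (1 :: complex)"
      by simp
    hence "of_int a * of_nat p + of_int b * of_int k = (1 :: complex)"
      by simp
    moreover have "of_int a * of_nat p + of_int b * of_int k \<in> M"
      by (intro add mult_left p_in k algebraic_int_of_int)
    ultimately show False using one_notin by simp
  qed
qed (rule of_int_in)

text \<open>Frobenius on residue classes modulo \<open>M\<close>, as a relation between arbitrary
  integral representatives; this form makes it an instance of \<open>ring_rel\<close>.\<close>

definition frob :: "complex \<Rightarrow> complex \<Rightarrow> bool" where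
  "frob x y \<longleftrightarrow> algebraic_int x \<and> algebraic_int y \<and> x ^ p - y \<in> M"

text \<open>All inner binomial coefficients are divisible by \<open>p\<close>, so their terms lie in
  \<open>M\<close>.\<close>

lemma power_prime_add:
  assumes x: "algebraic_int x" and y: "algebraic_int y"
  shows "(x + y) ^ p - (x ^ p + y ^ p) \<in> M"
proof -
  have "p > 0"
    using prime_p by (simp add: prime_gt_0_nat)
  have "(x + y) ^ p = (\<Sum>k\<le>p. of_nat (p choose k) * x ^ k * y ^ (p - k))"
    by (rule binomial_ring)
  also have "{..p} = insert 0 (insert p {0<..<p})"
    using \<open>p > 0\<close> by auto
  finally have "(x + y) ^ p - (x ^ p + y ^ p) =
      (\<Sum>k\<in>{0<..<p}. of_nat (p choose k) * x ^ k * y ^ (p - k))"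
    using \<open>p > 0\<close> by simp
  also have "\<dots> \<in> M"
  proof (rule sum)
    fix k assume "k \<in> {0<..<p}"
    hence "int p dvd int (p choose k)"
      using prime_p dvd_choose_prime[of k p] by auto
    from of_int_in[OF this] have "of_nat (p choose k) \<in> M"
      by simp
    thus "of_nat (p choose k) * x ^ k * y ^ (p - k) \<in> M"
      by (intro mult_right algebraic_int_power x y)
  qed
  finally show ?thesis .
qed

lemma ring_rel_frob: "ring_rel frob"
proof (rule ring_relI)
  show "frob (x + x') (y + y')" if "frob x y" "frob x' y'" for x y x' y'
  proof -
    have "((x + x') ^ p - (x ^ p + x' ^ p)) + (x ^ p - y) + (x' ^ p - y') \<in> M"
      using that by (intro add power_prime_add) (auto simp: frob_def)
    moreover have "((x + x') ^ p - (x ^ p + x' ^ p)) + (x ^ p - y) + (x' ^ p - y') =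
        (x + x') ^ p - (y + y')"
      by simp
    ultimately show ?thesis
      using that by (simp only: frob_def) (auto intro: algebraic_int_add)
  qed
  show "frob (x * x') (y * y')" if "frob x y" "frob x' y'" for x y x' y'
  proof -
    have "(x ^ p - y) * x' ^ p + y * (x' ^ p - y') \<in> M"
      using that by (intro add mult_left mult_right algebraic_int_power) (auto simp: frob_def)
    moreover have "(x ^ p - y) * x' ^ p + y * (x' ^ p - y') = (x * x') ^ p - y * y'"
      by (simp add: algebra_simps power_mult_distrib)
    ultimately show ?thesis
      using that by (simp only: frob_def) (auto intro: algebraic_int_times)
  qed
next
  have "(-1) ^ p - (-1) \<in> M"
  \<comment> \<open>For \<open>p = 2\<close> the difference is 2, an element of \<open>M\<close>;
    for odd \<open>p\<close> it is 0.\<close>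
  proof (cases "p = 2")
    case True
    thus ?thesis using p_in by simp
  next
    case False
    hence "odd p"
      using prime_p prime_odd_nat prime_gt_1_nat[OF prime_p] by force
    thus ?thesis by (simp add: zero)
  qed
  thus "frob (-1) (-1)"
    by (simp add: frob_def)
qed (use prime_gt_0_nat[OF prime_p] in \<open>simp_all add: frob_def zero power_0_left\<close>)

lemma frob_of_int: "frob (of_int k) (of_int k)"
proof -
  have nat: "frob (of_nat n) (of_nat n)" for n
    by (induction n) (simp_all add: ring_rel_zero[OF ring_rel_frob] ring_rel_one[OF ring_rel_frob]
        ring_rel_add[OF ring_rel_frob])
  show ?thesis
    using nat[of "nat k"] ring_rel_uminus[OF ring_rel_frob nat[of "nat (- k)"]]
    by (cases "k \<ge> 0") simp_all
qed

text \<open>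
  If \<open>F = \<Prod>\<^sub>a (X - u\<^sub>a)\<close> has integer coefficients, then raising the coefficients of all \<open>u\<^sub>a\<close>
  to the power \<open>p\<close> does not change \<open>F\<close> modulo \<open>M\<close>.
\<close>

lemma frobenius_permutes_conjugates:
  fixes u :: "'a \<Rightarrow> complex poly"
  assumes "finite A" and u: "\<And>a i. a \<in> A \<Longrightarrow> algebraic_int (coeff (u a) i)"
    and int: "\<And>k j. coeff (coeff (\<Prod>a\<in>A. [:- u a, 1:]) k) j \<in> \<int>" and "a \<in> A"
  shows "\<exists>b\<in>A. \<forall>i. coeff (u a) i ^ p - coeff (u b) i \<in> M"
proof -
  have p0: "p > 0"
    using prime_p by (simp add: prime_gt_0_nat)
  define v where "v = (\<lambda>a. map_poly (\<lambda>c. c ^ p) (u a))"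
  have v: "coeff (v a) i = coeff (u a) i ^ p" for a i
    using p0 by (simp add: v_def coeff_map_poly)
  define F where "F = (\<Prod>a\<in>A. [:- u a, 1:])"
  define G where "G = (\<Prod>a\<in>A. [:- v a, 1:])"
  have "coeff_rel (coeff_rel frob) F G"
    unfolding F_def G_def
    by (rule ring_rel_prod_linear[OF ring_rel_coeff_rel[OF ring_rel_frob]])
       (auto simp: coeff_rel_def frob_def v u zero algebraic_int_power)
  hence "coeff (coeff (F - G) k) j \<in> M" for k j
  proof -
    assume *: "coeff_rel (coeff_rel frob) F G"
    obtain c where c: "coeff (coeff F k) j = of_int c"
      using int[of k j] unfolding F_def by (rule Ints_cases)
    have "frob (of_int c) (coeff (coeff G k) j)"
      using * by (simp add: coeff_rel_def flip: c)
    with frob_of_int[of c] have "(of_int c ^ p - coeff (coeff G k) j) - (of_int c ^ p - of_int c) \<in> M"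
      by (intro diff[of "_ - _" "_ - _"]) (auto simp: frob_def)
    thus ?thesis by (simp add: c)
  qed
  hence FG: "coeff (coeff (F - G) k * v a ^ k) j \<in> M" for k j
  proof -
    assume *: "\<And>k j. coeff (coeff (F - G) k) j \<in> M"
    have "algebraic_int (coeff (v a ^ k) i)" for i
      using coeffs_algebraic_int_prod[of "{..<k}" "\<lambda>_. v a"] u[OF \<open>a \<in> A\<close>]
      by (simp add: v algebraic_int_power)
    thus ?thesis
      unfolding coeff_mult by (intro sum mult_right *)
  qed
  \<comment> \<open>As \<open>v a\<close> is a root of \<open>G\<close> and F \<equiv> G, all
    coefficients of F(v a) lie in \<open>M\<close>. Primality then selects one factor
    \<open>v a - u b\<close>.\<close>
  have "poly G (v a) = 0"
    using \<open>finite A\<close> \<open>a \<in> A\<close> by (auto simp: G_def poly_prod)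
  hence "(\<Prod>b\<in>A. v a - u b) = poly (F - G) (v a)"
    by (simp add: F_def poly_prod)
  also have "\<dots> = (\<Sum>k\<le>Polynomial.degree (F - G). coeff (F - G) k * v a ^ k)"
    by (rule poly_altdef)
  finally have "coeff (\<Prod>b\<in>A. v a - u b) j \<in> M" for j
    by (auto simp: coeff_sum simp del: coeff_diff intro!: sum FG)
  hence "\<exists>b\<in>A. \<forall>i. coeff (v a - u b) i \<in> M"
    by (intro coeffs_prod_in_prime \<open>finite A\<close>) 
       (auto simp: v intro!: algebraic_int_diff algebraic_int_power u \<open>a \<in> A\<close>)
  thus ?thesis by (simp add: v)
qed

end

section \<open>Conjugates in a normal extension\<close>

abbreviation rpoly :: "rat poly \<Rightarrow> complex \<Rightarrow> complex" where
  "rpoly P x \<equiv> poly (map_poly of_rat P) x"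

lemma of_rat_poly_pcompose:
  "map_poly (of_rat :: rat \<Rightarrow> complex) (P \<circ>\<^sub>p Q) = map_poly of_rat P \<circ>\<^sub>p map_poly of_rat Q"
  by (rule of_rat_hom.map_poly_pcompose)

lemma rpoly_simps [simp]:
  "rpoly (P + Q) x = rpoly P x + rpoly Q x"
  "rpoly (P * Q) x = rpoly P x * rpoly Q x"
  "rpoly (P - Q) x = rpoly P x - rpoly Q x"
  "rpoly (- P) x = - rpoly P x"
  "rpoly (P \<circ>\<^sub>p Q) x = rpoly P (rpoly Q x)"
proof -
  interpret hom: map_poly_comm_ring_hom "of_rat :: rat \<Rightarrow> complex" ..
  show "rpoly (P + Q) x = rpoly P x + rpoly Q x" "rpoly (P * Q) x = rpoly P x * rpoly Q x"
    "rpoly (P - Q) x = rpoly P x - rpoly Q x" "rpoly (- P) x = - rpoly P x"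
    "rpoly (P \<circ>\<^sub>p Q) x = rpoly P (rpoly Q x)"
    by (simp_all add: hom.hom_add hom.hom_mult hom.hom_minus hom.hom_uminus of_rat_poly_pcompose
        poly_pcompose)
qed

lemma rpoly_bezout:
  assumes "Rings.coprime P Q"
  obtains U V where "\<And>x. rpoly U x * rpoly P x + rpoly V x * rpoly Q x = 1"
proof -
  obtain U V where "U * P + V * Q = 1"
    using assms by (metis bezout_coefficients_fst_snd coprime_iff_gcd_eq_1)
  hence "rpoly (U * P + V * Q) x = 1" for x
    by simp
  thus ?thesis
    by (intro that[of U V]) simp
qed

text \<open>Otherwise \<open>f\<close> and \<open>h\<close> are coprime, and a Bezout identity
  evaluated at \<open>x\<close> reads 0 = 1.\<close>

lemma irreducible_dvd_if_common_root:
  assumes "Factorial_Ring.irreducible f" "rpoly f x = 0" "rpoly h x = 0"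
  shows "f dvd h"
proof (rule ccontr)
  assume "\<not> f dvd h"
  hence "Rings.coprime f h"
    using assms(1) by (simp add: irreducible_imp_prime_elem_gcd prime_elem_imp_coprime)
  then obtain U V where "\<And>x. rpoly U x * rpoly f x + rpoly V x * rpoly h x = 1"
    using rpoly_bezout by blast
  from this[of x] show False
    using assms(2,3) by simp
qed

text \<open>The difference \<open>P - Q\<close> is a multiple of \<open>f\<close>. Hence replacing
  one root by another is a well-defined map on values of polynomials.\<close>

lemma rpoly_eq_at_conjugate:
  assumes f: "Factorial_Ring.irreducible f" "rpoly f x = 0" "rpoly f y = 0"
    and "rpoly P x = rpoly Q x"
  shows "rpoly P y = rpoly Q y"
proof -
  have "f dvd P - Q"
    using assms by (intro irreducible_dvd_if_common_root[OF f(1,2)]) simp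
  then obtain R where "P - Q = f * R" ..
  hence "rpoly (P - Q) y = rpoly (f * R) y"
    by simp
  thus ?thesis
    using f(3) by simp
qed

text \<open>Polynomial values at \<alpha> are closed under the field operations. For inverses, a
  polynomial \<open>Q\<close> not vanishing at \<alpha> is coprime to \<open>f\<close>, and the
  Bezout coefficient of \<open>Q\<close> gives the inverse.\<close>

lemma rat_adjoin_eq_rpoly:
  assumes f: "Factorial_Ring.irreducible f" "rpoly f \<alpha> = 0"
    and x: "x \<in> rat_adjoin \<alpha>"
  shows "\<exists>Q. x = rpoly Q \<alpha>"
proof -
  interpret C: Ring.field complex_field
    by (rule field_from_type_algebra)
  have ops: "carrier complex_field = UNIV" "\<one>\<^bsub>complex_field\<^esub> = 1" "\<zero>\<^bsub>complex_field\<^esub> = 0"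
    "a \<oplus>\<^bsub>complex_field\<^esub> b = a + b" "a \<otimes>\<^bsub>complex_field\<^esub> b = a * b" for a b :: complex
    by (simp_all add: ring_of_type_algebra_def)
  have uminus_eq: "\<ominus>\<^bsub>complex_field\<^esub> a = - a" for a :: complex
    by (rule C.minus_equality) (simp_all add: ops)
  have inverse_eq: "inv\<^bsub>complex_field\<^esub> a = inverse a" if "a \<noteq> 0" for a :: complex
    using that by (intro C.inv_unique'[symmetric]) (simp_all add: ops)
  from x show ?thesis
    unfolding rat_adjoin_def
  proof (induction rule: generate_field.induct)
    case one
    show ?case by (rule exI[of _ 1]) (simp add: ops)
  next
    case (incl h)
    thus ?case by (intro exI[of _ "[:0, 1:]"]) simp
  next
    case (a_inv h)
    then obtain Q where "h = rpoly Q \<alpha>" by blast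
    thus ?case by (intro exI[of _ "- Q"]) (simp add: uminus_eq)
  next
    case (m_inv h)
    then obtain Q where Q: "h = rpoly Q \<alpha>" by blast
    have "h \<noteq> 0"
      using m_inv.hyps by (simp add: ops)
    have "\<not> f dvd Q"
    proof
      assume "f dvd Q"
      then obtain R where "Q = f * R" ..
      thus False
        using f(2) \<open>h \<noteq> 0\<close> by (simp add: Q)
    qed
    hence "Rings.coprime f Q"
      using f(1) by (simp add: irreducible_imp_prime_elem_gcd prime_elem_imp_coprime)
    then obtain U V where "\<And>x. rpoly U x * rpoly f x + rpoly V x * rpoly Q x = 1"
      using rpoly_bezout by blast
    from this[of \<alpha>] have "rpoly V \<alpha> * h = 1"
      using f(2) by (simp add: Q)
    hence "inverse h = rpoly V \<alpha>"
      using \<open>h \<noteq> 0\<close> by (simp add: field_simps)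
    thus ?case
      using \<open>h \<noteq> 0\<close> by (auto simp: inverse_eq)
  next
    case (eng_add h1 h2)
    then obtain Q R where "h1 = rpoly Q \<alpha>" "h2 = rpoly R \<alpha>" by blast
    thus ?case by (intro exI[of _ "Q + R"]) (simp add: ops)
  next
    case (eng_mult h1 h2)
    then obtain Q R where "h1 = rpoly Q \<alpha>" "h2 = rpoly R \<alpha>" by blast
    thus ?case by (intro exI[of _ "Q * R"]) (simp add: ops)
  qed
qed

lemma splits_over_root_mem:
  assumes "splits_over L q" "q \<noteq> 0" "rpoly q x = 0"
  shows "x \<in> L"
proof -
  obtain c xs where xs: "set xs \<subseteq> L" "map_poly of_rat q = Polynomial.smult c (\<Prod>x\<leftarrow>xs. [:- x, 1:])"
    using assms(1) by (auto simp: splits_over_def)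
  have "c \<noteq> 0"
    using assms(2) xs(2) by auto
  hence "(\<Prod>y\<leftarrow>xs. x - y) = 0"
    using assms(3) by (simp add: xs(2) poly_prod_list o_def)
  hence "x \<in> set xs"
    by (auto simp: prod_list_zero_iff)
  thus ?thesis
    using xs(1) by blast
qed

text \<open>Separability in characteristic zero: a multiple root would make \<open>f\<close> divide
  its derivative, which is nonzero and of smaller degree.\<close>

lemma card_roots_irreducible:
  fixes f :: "rat poly"
  assumes f: "Factorial_Ring.irreducible f"
  shows "card {x. rpoly f x = 0} = Polynomial.degree f"
proof -
  have "f \<noteq> 0" and deg: "Polynomial.degree f > 0"
    using f by (auto simp: irreducible_def is_unit_iff_degree)
  have "poly (pderiv (map_poly of_rat f)) x \<noteq> 0" if "rpoly f x = 0" for x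
  proof
    assume "poly (pderiv (map_poly of_rat f)) x = 0"
    moreover have "pderiv (map_poly of_rat f) = (map_poly of_rat (pderiv f) :: complex poly)"
      by (simp add: of_rat_hom.map_poly_pderiv)
    ultimately have "f dvd pderiv f"
      using that by (intro irreducible_dvd_if_common_root[OF f]) auto
    moreover have "pderiv f \<noteq> 0"
      using deg by (simp add: pderiv_eq_0_iff)
    ultimately have "Polynomial.degree f \<le> Polynomial.degree (pderiv f)"
      by (rule dvd_imp_degree_le)
    thus False
      using deg by (simp add: degree_pderiv)
  qed
  hence "rsquarefree (map_poly of_rat f :: complex poly)"
    by (auto simp: rsquarefree_roots)
  thus ?thesis
    using rsquarefree_card_degree[of "map_poly of_rat f :: complex poly"] \<open>f \<noteq> 0\<close>
    by (simp add: degree_map_poly)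
qed

text \<open>Gauss's lemma, applicable because a monic polynomial is primitive.\<close>

lemma irreducible_of_int_poly:
  fixes f :: "int poly"
  assumes "lead_coeff f = 1" "Factorial_Ring.irreducible f"
  shows "Factorial_Ring.irreducible (map_poly rat_of_int f)"
proof -
  have "content f = 1"
    using assms(1) content_dvd_coeff[of f "Polynomial.degree f"]
    by (metis is_unit_normalize normalize_content)
  hence "irreducible\<^sub>d f"
    using assms(2) irreducible_primitive_connect[of f] by (simp add: primitive_iff_content_eq_1)
  from irreducible\<^sub>d_int_rat[OF this] show ?thesis
    by (simp add: irreducible_connect_field)
qed

lemma rpoly_of_int_poly: "rpoly (map_poly rat_of_int f) x = poly (map_poly of_int f) x"
  by (simp add: map_poly_map_poly o_def)

text \<open>Normality of \<rat>(\<alpha>) takes the form in which it is used: all roots of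
  \<open>f\<close> are rational polynomials in \<alpha>.\<close>

locale normal_conjugates =
  fixes f :: "int poly" and \<alpha> :: complex
  assumes monic: "lead_coeff f = 1"
    and irred: "Factorial_Ring.irreducible (map_poly rat_of_int f)"
    and root: "poly (map_poly of_int f) \<alpha> = 0"
    and normal: "poly (map_poly of_int f) a = 0 \<Longrightarrow> \<exists>Q. a = rpoly Q \<alpha>"
begin

section \<open>The Galois group acting on the conjugates\<close>

definition conjs :: "complex set" where
  "conjs = {a. poly (map_poly of_int f) a = 0}"

text \<open>For a conjugate \<open>a\<close> the choice of polynomial is harmless: by
  \<open>eq_at_conj\<close> its values at all conjugates are determined by its value at
  \<alpha>.\<close>

definition expr :: "complex \<Rightarrow> rat poly" where
  "expr a = (SOME Q. a = rpoly Q \<alpha>)"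

text \<open>The value at \<open>b\<close> of the automorphism of \<open>\<rat>(\<alpha>)\<close> that maps \<open>\<alpha>\<close> to \<open>a\<close>.\<close>

definition conj_map :: "complex \<Rightarrow> complex \<Rightarrow> complex" where
  "conj_map a b = rpoly (expr b) a"

lemma conjs_rpoly: "a \<in> conjs \<longleftrightarrow> rpoly (map_poly rat_of_int f) a = 0"
  by (simp add: conjs_def rpoly_of_int_poly)

lemma gen_in_conjs: "\<alpha> \<in> conjs"
  using root by (simp add: conjs_def)

lemma degree_pos: "Polynomial.degree f > 0"
  using monic root by (auto intro!: Nat.gr0I elim!: degree_eq_zeroE)

lemma card_conjs: "card conjs = Polynomial.degree f"
  using card_roots_irreducible[OF irred] by (simp add: conjs_def rpoly_of_int_poly degree_map_poly)

lemma finite_conjs: "finite conjs"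
  using card_conjs degree_pos card_ge_0_finite by force

lemma algebraic_int_conjs: "a \<in> conjs \<Longrightarrow> algebraic_int a"
  using monic by (auto simp: conjs_def algebraic_int_altdef_ipoly)

lemma expr: "a \<in> conjs \<Longrightarrow> rpoly (expr a) \<alpha> = a"
  unfolding expr_def using someI_ex[OF normal[of a]] by (simp add: conjs_def)

lemma eq_at_conj:
  assumes "x \<in> conjs" "y \<in> conjs" "rpoly P x = rpoly Q x"
  shows "rpoly P y = rpoly Q y"
  by (rule rpoly_eq_at_conjugate[OF irred _ _ assms(3)]) (use assms(1,2) in \<open>simp_all add: conjs_rpoly\<close>)

lemma conj_map_in_conjs:
  assumes "a \<in> conjs" "b \<in> conjs"
  shows "conj_map a b \<in> conjs"
proof -
  have "rpoly (map_poly rat_of_int f \<circ>\<^sub>p expr b) a = rpoly 0 a"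
    by (rule eq_at_conj[OF gen_in_conjs]) (use assms in \<open>simp_all add: expr flip: conjs_rpoly\<close>)
  thus ?thesis
    by (simp add: conj_map_def conjs_rpoly)
qed

lemma conj_map_gen_left: "b \<in> conjs \<Longrightarrow> conj_map \<alpha> b = b"
  by (simp add: conj_map_def expr)

lemma conj_map_gen_right:
  assumes "a \<in> conjs"
  shows "conj_map a \<alpha> = a"
proof -
  have "rpoly (expr \<alpha>) a = rpoly [:0, 1:] a"
    by (rule eq_at_conj[OF gen_in_conjs]) (simp_all add: expr gen_in_conjs assms)
  thus ?thesis
    by (simp add: conj_map_def)
qed

text \<open>The automorphism \<alpha> \<mapsto> b followed by \<alpha> \<mapsto> a sends \<alpha> to
  \<open>conj_map a b\<close>. Both polynomials compared here take the value
  \<open>conj_map b c\<close> at \<alpha>, so they agree at \<open>a\<close>.\<close>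

lemma conj_map_assoc:
  assumes "a \<in> conjs" "b \<in> conjs" "c \<in> conjs"
  shows "conj_map (conj_map a b) c = conj_map a (conj_map b c)"
proof -
  have "rpoly (expr c \<circ>\<^sub>p expr b) a = rpoly (expr (conj_map b c)) a"
    by (rule eq_at_conj[OF gen_in_conjs])
       (use assms in \<open>simp_all add: expr conj_map_in_conjs conj_map_gen_left flip: conj_map_def\<close>)
  thus ?thesis
    by (simp add: conj_map_def)
qed

lemma inj_on_conj_map:
  assumes "a \<in> conjs"
  shows "inj_on (conj_map a) conjs"
proof (rule inj_onI)
  fix b c assume *: "b \<in> conjs" "c \<in> conjs" "conj_map a b = conj_map a c"
  have "rpoly (expr b) \<alpha> = rpoly (expr c) \<alpha>"
    by (rule eq_at_conj[OF assms gen_in_conjs]) (use *(3) in \<open>simp add: conj_map_def\<close>)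
  thus "b = c"
    using * by (simp add: expr)
qed

lemma bij_betw_conj_map:
  assumes "a \<in> conjs"
  shows "bij_betw (conj_map a) conjs conjs"
  using endo_inj_surj[OF finite_conjs _ inj_on_conj_map[OF assms]] conj_map_in_conjs[OF assms]
    inj_on_conj_map[OF assms] by (auto simp: bij_betw_def)

text \<open>The Galois group of \<rat>(\<alpha>), each automorphism being represented by its value
  at \<alpha>.\<close>

definition conj_group :: "complex monoid" where
  "conj_group = \<lparr>carrier = conjs, monoid.mult = conj_map, one = \<alpha>\<rparr>"

lemma group_conj_group: "group conj_group"
proof (rule groupI)
  fix a assume "a \<in> carrier conj_group"
  hence a: "a \<in> conjs"
    by (simp add: conj_group_def)
  have right_inv: "\<exists>b\<in>conjs. conj_map a b = \<alpha>" if "a \<in> conjs" for a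
    using bij_betw_conj_map[OF that] gen_in_conjs by (metis bij_betw_imp_surj_on imageE)
  obtain b c where b: "b \<in> conjs" "conj_map a b = \<alpha>" and c: "c \<in> conjs" "conj_map b c = \<alpha>"
    using right_inv a by metis
  \<comment> \<open>The right inverse \<open>b\<close> of \<open>a\<close> has a right inverse
    \<open>c\<close>; associativity forces \<open>c = a\<close>, so \<open>b\<close> is also a left
    inverse.\<close>
  have "a = c"
    using conj_map_assoc[OF a b(1) c(1)] a b c by (simp add: conj_map_gen_left conj_map_gen_right)
  thus "\<exists>b\<in>carrier conj_group. b \<otimes>\<^bsub>conj_group\<^esub> a = \<one>\<^bsub>conj_group\<^esub>"
    using b c by (auto simp: conj_group_def)
qed (simp_all add: conj_group_def conj_map_in_conjs conj_map_assoc conj_map_gen_left gen_in_conjs)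

text \<open>Iterates of \<open>conj_map a\<close> at \<alpha> are the powers of \<open>a\<close> in
  \<open>conj_group\<close>, whose order is the degree of \<open>f\<close>.\<close>

lemma conj_map_funpow:
  assumes "a \<in> conjs"
  shows "(conj_map a ^^ Polynomial.degree f) \<alpha> = \<alpha>"
proof -
  interpret group conj_group
    by (rule group_conj_group)
  have a: "a \<in> carrier conj_group"
    using assms by (simp add: conj_group_def)
  have "(conj_map a ^^ k) \<alpha> = a [^]\<^bsub>conj_group\<^esub> k" for k :: nat
  proof (induction k)
    case 0
    show ?case by (simp add: conj_group_def)
  next
    case (Suc k)
    thus ?case
      using nat_pow_Suc2[OF a] by (simp del: nat_pow_Suc) (simp add: conj_group_def)
  qed
  moreover have "Coset.order conj_group = Polynomial.degree f"
    by (simp add: Coset.order_def conj_group_def card_conjs)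
  ultimately show ?thesis
    using pow_order_eq_1[OF a] by (simp add: conj_group_def)
qed

text \<open>The graph of the automorphism that maps \<open>\<alpha>\<close> to \<open>a\<close>.\<close>

definition conj_pair :: "complex \<Rightarrow> complex \<Rightarrow> complex \<Rightarrow> bool" where
  "conj_pair a x y \<longleftrightarrow> (\<exists>Q. x = rpoly Q \<alpha> \<and> y = rpoly Q a)"

lemma ring_rel_conj_pair: "ring_rel (conj_pair a)"
proof (rule ring_relI)
  show "conj_pair a 0 0"
    unfolding conj_pair_def by (rule exI[of _ 0]) simp
  show "conj_pair a 1 1"
    unfolding conj_pair_def by (rule exI[of _ 1]) simp
  show "conj_pair a (-1) (-1)"
    unfolding conj_pair_def by (rule exI[of _ "-1"]) simp
next
  fix x y x' y' assume "conj_pair a x y" "conj_pair a x' y'"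
  then obtain Q Q' where *: "x = rpoly Q \<alpha>" "y = rpoly Q a" "x' = rpoly Q' \<alpha>" "y' = rpoly Q' a"
    by (auto simp: conj_pair_def)
  show "conj_pair a (x + x') (y + y')"
    unfolding conj_pair_def by (rule exI[of _ "Q + Q'"]) (simp add: *)
  show "conj_pair a (x * x') (y * y')"
    unfolding conj_pair_def by (rule exI[of _ "Q * Q'"]) (simp add: *)
qed

text \<open>Write c = Q(\<alpha>). Modulo \<open>f\<close>, the polynomial \<open>Q\<close> has
  degree below the number of conjugates and takes the value \<open>c\<close> at all of them, so it
  is constant.\<close>

lemma rational_if_invariant:
  assumes "\<And>a. a \<in> conjs \<Longrightarrow> conj_pair a c c"
  shows "c \<in> \<rat>"
proof -
  obtain Q where Q: "c = rpoly Q \<alpha>"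
    using assms[OF gen_in_conjs] by (auto simp: conj_pair_def)
  have c: "rpoly Q a = c" if a: "a \<in> conjs" for a
  proof -
    \<comment> \<open>The witness of invariance may depend on \<open>a\<close>; its agreement with
      \<open>Q\<close> at \<alpha> carries over to \<open>a\<close>.\<close>
    obtain Q' where Q': "c = rpoly Q' \<alpha>" "c = rpoly Q' a"
      using assms[OF a] unfolding conj_pair_def by blast
    have "rpoly Q \<alpha> = rpoly Q' \<alpha>"
      using Q Q' by simp
    from eq_at_conj[OF gen_in_conjs a this] show ?thesis
      using Q' by simp
  qed
  define F where "F = map_poly rat_of_int f"
  have deg_F: "Polynomial.degree F = card conjs"
    by (simp add: F_def card_conjs degree_map_poly)
  have "F \<noteq> 0"
    using degree_pos deg_F by (auto simp: card_conjs)
  have "Polynomial.degree (Q mod F) < card conjs"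
    using degree_mod_less'[OF \<open>F \<noteq> 0\<close>, of Q] degree_pos
    by (cases "Q mod F = 0") (auto simp: deg_F card_conjs)
  have "map_poly of_rat (Q mod F) = [:c:]"
  proof (rule poly_eqI_degree[of conjs])
    fix a assume a: "a \<in> conjs"
    have "rpoly (Q div F * F + Q mod F) a = c"
      using c[OF a] by (simp only: div_mult_mod_eq)
    thus "rpoly (Q mod F) a = poly [:c:] a"
      using a by (simp add: F_def conjs_rpoly)
  qed (use \<open>Polynomial.degree (Q mod F) < card conjs\<close> degree_pos in \<open>simp_all add: degree_map_poly card_conjs\<close>)
  hence "coeff (map_poly of_rat (Q mod F)) 0 = c"
    by simp
  hence "c = of_rat (coeff (Q mod F) 0)"
    by (simp add: coeff_map_poly)
  thus ?thesis
    by simp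
qed

text \<open>Each automorphism permutes the factors, so the coefficients are invariant and therefore
  rational; being algebraic integers as well, they are integers.\<close>

lemma int_coeffs_prod_conj:
  fixes u :: "complex \<Rightarrow> complex poly"
  assumes u: "\<And>a i. a \<in> conjs \<Longrightarrow> algebraic_int (coeff (u a) i)"
    and equivariant: "\<And>a b. a \<in> conjs \<Longrightarrow> b \<in> conjs \<Longrightarrow> coeff_rel (conj_pair a) (u b) (u (conj_map a b))"
  shows "coeff (coeff (\<Prod>a\<in>conjs. [:- u a, 1:]) k) j \<in> \<int>"
proof (rule rational_algebraic_int_is_int)
  \<comment> \<open>This relation records only integrality, so the transfer lemma yields integrality
    of the coefficients.\<close>
  have "ring_rel (\<lambda>(x :: complex) (y :: complex). algebraic_int x \<and> algebraic_int y)"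
    by (rule ring_relI) (auto intro: algebraic_int_add algebraic_int_times)
  from ring_rel_prod_linear[OF ring_rel_coeff_rel[OF this], of conjs u u]
  show "algebraic_int (coeff (coeff (\<Prod>a\<in>conjs. [:- u a, 1:]) k) j)"
    using u by (simp add: coeff_rel_def)
  show "coeff (coeff (\<Prod>a\<in>conjs. [:- u a, 1:]) k) j \<in> \<rat>"
  proof (rule rational_if_invariant)
    fix a assume a: "a \<in> conjs"
    have "coeff_rel (coeff_rel (conj_pair a)) (\<Prod>b\<in>conjs. [:- u b, 1:])
        (\<Prod>b\<in>conjs. [:- u (conj_map a b), 1:])"
      by (rule ring_rel_prod_linear[OF ring_rel_coeff_rel[OF ring_rel_conj_pair]]) (rule equivariant[OF a])
    also have "(\<Prod>b\<in>conjs. [:- u (conj_map a b), 1:]) = (\<Prod>b\<in>conjs. [:- u b, 1:])"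
      by (rule prod.reindex_bij_betw[OF bij_betw_conj_map[OF a]])
    finally show "conj_pair a (coeff (coeff (\<Prod>a\<in>conjs. [:- u a, 1:]) k) j)
        (coeff (coeff (\<Prod>a\<in>conjs. [:- u a, 1:]) k) j)"
      by (simp add: coeff_rel_def)
  qed
qed

end

section \<open>Frobenius modulo \<open>M\<close> as a Galois automorphism\<close>

lemma (in alg_int_prime) power_cong:
  assumes "algebraic_int x" "algebraic_int y" "x - y \<in> M"
  shows "x ^ n - y ^ n \<in> M"
proof -
  have "x ^ n - y ^ n = (x - y) * (\<Sum>i<n. y ^ (n - Suc i) * x ^ i)"
    by (rule power_diff_sumr2)
  also have "\<dots> \<in> M"
    using assms by (intro mult_right algebraic_int_sum algebraic_int_times algebraic_int_power)
  finally show ?thesis .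
qed

locale normal_mod_prime = normal_conjugates f \<alpha> + alg_int_prime_over M p
  for f :: "int poly" and \<alpha> :: complex and M :: "complex set" and p :: nat
begin

text \<open>
  The formal variable separates the conjugates: a single \<open>a\<close> must serve all \<open>b\<close> at once, which
  is what makes \<open>conj_map a\<close> iterable.
\<close>

lemma ex_frobenius_conj:
  obtains a where "a \<in> conjs" "\<And>b. b \<in> conjs \<Longrightarrow> b ^ p - conj_map a b \<in> M"
proof -
  obtain h where h: "bij_betw h {0..<card conjs} conjs"
    using ex_bij_betw_nat_finite[OF finite_conjs] by blast
  have h_in: "h i \<in> conjs" if "i < card conjs" for i
    using h that by (auto simp: bij_betw_def)
  \<comment> \<open>The coefficients of \<open>u a\<close> list the images of all conjugates under
    \<alpha> \<mapsto> a; those of \<open>u \<alpha>\<close> are the conjugates themselves.\<close>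
  define u where "u = (\<lambda>a. \<Sum>i<card conjs. Polynomial.monom (conj_map a (h i)) i)"
  have u: "coeff (u a) i = (if i < card conjs then conj_map a (h i) else 0)" for a i
    by (simp add: u_def coeff_sum)
  have "\<exists>b\<in>conjs. \<forall>i. coeff (u \<alpha>) i ^ p - coeff (u b) i \<in> M"
  proof (rule frobenius_permutes_conjugates[OF finite_conjs _ int_coeffs_prod_conj gen_in_conjs])
    show int: "algebraic_int (coeff (u a) i)" if "a \<in> conjs" for a i
      using that by (simp add: u algebraic_int_conjs conj_map_in_conjs h_in)
    show "algebraic_int (coeff (u a) i)" if "a \<in> conjs" for a i
      using that by (rule int)
    fix a b assume ab: "a \<in> conjs" "b \<in> conjs"
    have "conj_pair a (conj_map b c) (conj_map (conj_map a b) c)" for c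
      unfolding conj_pair_def 
      \<comment> \<open>At \<alpha> the inner polynomial gives \<open>b\<close>, at \<open>a\<close>
        it gives \<open>conj_map a b\<close>.\<close>
      by (rule exI[of _ "expr c \<circ>\<^sub>p expr b"]) (use ab in \<open>simp add: conj_map_def expr\<close>)
    thus "coeff_rel (conj_pair a) (u b) (u (conj_map a b))"
      by (simp add: coeff_rel_def u ring_rel_zero[OF ring_rel_conj_pair])
  qed
  then obtain a where a: "a \<in> conjs" "\<And>i. coeff (u \<alpha>) i ^ p - coeff (u a) i \<in> M"
    by blast
  show ?thesis
  proof (rule that[OF a(1)])
    fix b assume "b \<in> conjs"
    then obtain i where "i < card conjs" "b = h i"
      using h unfolding bij_betw_def by (metis atLeastLessThan_iff imageE)
    thus "b ^ p - conj_map a b \<in> M"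
      using a(2)[of i] \<open>b \<in> conjs\<close> by (simp add: u conj_map_gen_left)
  qed
qed

text \<open>The power \<open>\<alpha> ^ (p ^ k)\<close> is congruent to the \<open>k\<close>-th
  iterate of \<open>conj_map a\<close> at \<alpha>, which returns to \<alpha> at the degree of
  \<open>f\<close>. The induction also tracks membership in \<open>conjs\<close>, where
  \<open>a\<close> is known to represent Frobenius.\<close>

lemma frobenius_power_degree: "\<alpha> ^ (p ^ Polynomial.degree f) - \<alpha> \<in> M"
proof -
  obtain a where a: "a \<in> conjs" "\<And>b. b \<in> conjs \<Longrightarrow> b ^ p - conj_map a b \<in> M"
    using ex_frobenius_conj by blast
  have "(conj_map a ^^ k) \<alpha> \<in> conjs \<and> \<alpha> ^ (p ^ k) - (conj_map a ^^ k) \<alpha> \<in> M" for k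
  proof (induction k)
    case 0
    show ?case by (simp add: gen_in_conjs zero)
  next
    case (Suc k)
    define b where "b = (conj_map a ^^ k) \<alpha>"
    have b: "b \<in> conjs" "\<alpha> ^ (p ^ k) - b \<in> M"
      using Suc by (simp_all add: b_def)
    have "((\<alpha> ^ (p ^ k)) ^ p - b ^ p) + (b ^ p - conj_map a b) \<in> M"
      using b gen_in_conjs
      by (intro add power_cong a(2)) (auto intro: algebraic_int_power algebraic_int_conjs)
    thus ?case
      using conj_map_in_conjs[OF a(1) b(1)] by (simp add: b_def mult.commute flip: power_mult)
  qed
  from this[of "Polynomial.degree f"] show ?thesis
    using conj_map_funpow[OF a(1)] by simp
qed

end

section \<open>First-degree primes and residues\<close>

lemma int_adjoin_simps:
  "carrier (int_adjoin \<theta>) = generate_ring complex_field {\<theta>}"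
  "\<one>\<^bsub>int_adjoin \<theta>\<^esub> = 1" "\<zero>\<^bsub>int_adjoin \<theta>\<^esub> = 0"
  "a \<oplus>\<^bsub>int_adjoin \<theta>\<^esub> b = a + b" "a \<otimes>\<^bsub>int_adjoin \<theta>\<^esub> b = a * b"
  by (simp_all add: int_adjoin_def ring_of_type_algebra_def)

lemma cring_int_adjoin: "cring (int_adjoin \<theta>)"
proof -
  interpret C: cring complex_field
    by (rule cring_from_type_algebra)
  have "subring (generate_ring complex_field {\<theta>}) complex_field"
    by (rule C.generate_ring_is_subring) (simp add: ring_of_type_algebra_def)
  thus ?thesis
    using C.subcring_iff[of "generate_ring complex_field {\<theta>}"] C.subcringI'
    by (auto simp: int_adjoin_def ring_of_type_algebra_def)
qed

lemma int_adjoin_uminus: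
  assumes "x \<in> carrier (int_adjoin \<theta>)"
  shows "- x \<in> carrier (int_adjoin \<theta>)" "\<ominus>\<^bsub>int_adjoin \<theta>\<^esub> x = - x"
proof -
  interpret R: cring "int_adjoin \<theta>"
    by (rule cring_int_adjoin)
  have "\<ominus>\<^bsub>int_adjoin \<theta>\<^esub> x + x = 0"
    using R.l_neg[OF assms] by (simp add: int_adjoin_simps)
  thus "\<ominus>\<^bsub>int_adjoin \<theta>\<^esub> x = - x"
    by (simp add: add_eq_0_iff2)
  thus "- x \<in> carrier (int_adjoin \<theta>)"
    using R.a_inv_closed[OF assms] by simp
qed

lemma gen_in_int_adjoin: "\<theta> \<in> carrier (int_adjoin \<theta>)"
  by (simp add: int_adjoin_simps generate_ring.incl)

lemma of_int_in_int_adjoin: "of_int k \<in> carrier (int_adjoin \<theta>)"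
proof -
  interpret R: cring "int_adjoin \<theta>"
    by (rule cring_int_adjoin)
  have nat: "of_nat n \<in> carrier (int_adjoin \<theta>)" for n
  proof (induction n)
    case 0
    show ?case using R.zero_closed by (simp add: int_adjoin_simps)
  next
    case (Suc n)
    thus ?case using R.a_closed[OF R.one_closed Suc] by (simp add: int_adjoin_simps)
  qed
  show ?thesis
    using nat[of "nat k"] int_adjoin_uminus(1)[OF nat[of "nat (- k)"]] by (cases "k \<ge> 0") simp_all
qed

text \<open>The homomorphism is reduction modulo \<open>p\<close> on integers, and Horner's scheme
  extends this to polynomials in \<theta>. Membership is proved alongside, since the homomorphism
  laws require it.\<close>

lemma hom_int_adjoin_poly:
  assumes p: "p > 1" and \<phi>: "\<phi> \<in> Ring.ring_hom (int_adjoin \<theta>) (residue_ring (int p))"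
  shows "poly (map_poly of_int P) \<theta> \<in> carrier (int_adjoin \<theta>) \<and>
         \<phi> (poly (map_poly of_int P) \<theta>) = poly P (\<phi> \<theta>) mod int p"
proof -
  interpret R: cring "int_adjoin \<theta>"
    by (rule cring_int_adjoin)
  interpret S: residues "int p" "residue_ring (int p)"
    by unfold_locales (use p in auto)
  interpret \<phi>: ring_hom_ring "int_adjoin \<theta>" "residue_ring (int p)" \<phi>
    by (rule ring_hom_ringI2[OF R.ring_axioms S.ring_axioms \<phi>])
  have nat: "\<phi> (of_nat n) = int n mod int p" for n
  proof (induction n)
    case 0
    show ?case using \<phi>.hom_zero by (simp add: int_adjoin_simps S.res_zero_eq)
  next
    case (Suc n)
    have "\<phi> (of_nat (Suc n)) = \<phi> (1 \<oplus>\<^bsub>int_adjoin \<theta>\<^esub> of_nat n)"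
      by (simp add: int_adjoin_simps)
    also have "\<dots> = (\<phi> 1 + \<phi> (of_nat n)) mod int p"
      using of_int_in_int_adjoin[of 1 \<theta>] of_int_in_int_adjoin[of "int n" \<theta>]
      by (subst \<phi>.hom_add) (simp_all add: S.res_add_eq)
    also have "\<phi> 1 = 1"
      using \<phi>.hom_one by (simp add: int_adjoin_simps S.res_one_eq)
    finally show ?case
      by (simp add: Suc mod_simps)
  qed
  have int: "\<phi> (of_int k) = k mod int p" for k
  proof (cases "k \<ge> 0")
    case True
    thus ?thesis using nat[of "nat k"] by simp
  next
    case False
    have "\<phi> (of_int k) = \<phi> (\<ominus>\<^bsub>int_adjoin \<theta>\<^esub> of_int (- k))"
      using int_adjoin_uminus(2)[OF of_int_in_int_adjoin[of "- k" \<theta>]] by simp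
    also have "\<dots> = (- \<phi> (of_int (- k))) mod int p"
      by (subst \<phi>.hom_a_inv[OF of_int_in_int_adjoin]) (simp add: S.res_neg_eq)
    also have "\<phi> (of_int (- k)) = - k mod int p"
      using nat[of "nat (- k)"] False by simp
    finally show ?thesis
      by (simp add: mod_simps)
  qed
  show ?thesis
  proof (induction P)
    case 0
    show ?case using int[of 0] of_int_in_int_adjoin[of 0 \<theta>] by simp
  next
    case (pCons a P)
    define x where "x = poly (map_poly of_int P) \<theta>"
    have x: "x \<in> carrier (int_adjoin \<theta>)" "\<phi> x = poly P (\<phi> \<theta>) mod int p"
      using pCons by (simp_all add: x_def)
    have eq: "poly (map_poly of_int (pCons a P)) \<theta> =
        of_int a \<oplus>\<^bsub>int_adjoin \<theta>\<^esub> \<theta> \<otimes>\<^bsub>int_adjoin \<theta>\<^esub> x"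
      using pCons.hyps by (simp add: x_def int_adjoin_simps map_poly_pCons)
    have "poly (map_poly of_int (pCons a P)) \<theta> \<in> carrier (int_adjoin \<theta>)"
      unfolding eq by (intro R.a_closed R.m_closed of_int_in_int_adjoin gen_in_int_adjoin x)
    moreover have "\<phi> (poly (map_poly of_int (pCons a P)) \<theta>) = poly (pCons a P) (\<phi> \<theta>) mod int p"
      unfolding eq using x gen_in_int_adjoin of_int_in_int_adjoin
      by (simp add: int S.res_add_eq S.res_mult_eq mod_simps)
    ultimately show ?case ..
  qed
qed

lemma first_degree_prime_pairD:
  assumes "first_degree_prime_pair \<theta> t p"
  shows "Factorial_Ring.prime p" "0 \<le> t" "t < int p"
    and "\<And>P :: int poly. poly (map_poly of_int P) \<theta> = 0 \<Longrightarrow> int p dvd poly P t"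
proof -
  from assms obtain \<phi> where p: "Factorial_Ring.prime p"
    and \<phi>: "\<phi> \<in> Ring.ring_hom (int_adjoin \<theta>) (residue_ring (int p))" "\<phi> \<theta> = t"
    unfolding first_degree_prime_pair_def first_degree_prime_ideal_def pair_denotes_def by blast
  show "Factorial_Ring.prime p"
    by (rule p)
  have "p > 1"
    using p by (rule prime_gt_1_nat)
  have "t \<in> carrier (residue_ring (int p))"
    using ring_hom_closed[OF \<phi>(1) gen_in_int_adjoin] \<phi>(2) by simp
  thus "0 \<le> t" "t < int p"
    by (auto simp: residue_ring_def)
  show "int p dvd poly P t" if "poly (map_poly of_int P) \<theta> = 0" for P
    \<comment> \<open>The instance for the zero polynomial gives the value of \<open>\<phi>\<close>
      at 0, to be compared with \<open>poly P t mod int p\<close>.\<close>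
    using hom_int_adjoin_poly[OF \<open>p > 1\<close> \<phi>(1), of P] hom_int_adjoin_poly[OF \<open>p > 1\<close> \<phi>(1), of 0] that \<phi>(2)
    by (simp add: mod_eq_0_iff_dvd)
qed

section \<open>Residues modulo \<open>M\<close> and the ideals they define\<close>

context alg_int_prime_over
begin

text \<open>Meaningful for numbers congruent to an integer modulo \<open>M\<close>; on
  \<int>[\<theta>] it becomes the homomorphism to the field with \<open>p\<close> elements.\<close>

definition residue :: "complex \<Rightarrow> int" where
  "residue x = (THE c. 0 \<le> c \<and> c < int p \<and> x - of_int c \<in> M)"

lemma residue_eqI:
  assumes "0 \<le> c" "c < int p" "x - of_int c \<in> M"
  shows "residue x = c"
  unfolding residue_def
proof (rule the_equality)
  fix d assume d: "0 \<le> d \<and> d < int p \<and> x - of_int d \<in> M"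
  have "(x - of_int d) - (x - of_int c) \<in> M"
    using d assms by (intro diff[of "_ - _" "_ - _"]) auto
  hence "of_int (c - d) \<in> M"
    by simp
  hence "c mod int p = d mod int p"
    by (simp add: of_int_in_iff mod_eq_dvd_iff del: of_int_diff)
  thus "d = c"
    using d assms by simp
qed (use assms in auto)

lemma residue_mod_eqI:
  assumes "x - of_int c \<in> M"
  shows "residue x = c mod int p"
proof (rule residue_eqI)
  have "of_int (c - c mod int p) \<in> M"
    by (intro of_int_in) simp
  from add[OF assms this] show "x - of_int (c mod int p) \<in> M"
    by simp
qed (use prime_gt_0_nat[OF prime_p] in auto)

text \<open>Being congruent to an integer is preserved by the ring operations. Integrality is
  carried along because \<open>M\<close> absorbs only algebraic integers.\<close>

lemma int_adjoin_cong_int: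
  assumes \<theta>: "algebraic_int \<theta>" "\<theta> - of_int r \<in> M" and x: "x \<in> carrier (int_adjoin \<theta>)"
  shows "algebraic_int x \<and> (\<exists>c. x - of_int c \<in> M)"
proof -
  interpret C: cring complex_field
    by (rule cring_from_type_algebra)
  have ops: "carrier complex_field = UNIV" "\<one>\<^bsub>complex_field\<^esub> = 1" "\<zero>\<^bsub>complex_field\<^esub> = 0"
    "a \<oplus>\<^bsub>complex_field\<^esub> b = a + b" "a \<otimes>\<^bsub>complex_field\<^esub> b = a * b" for a b :: complex
    by (simp_all add: ring_of_type_algebra_def)
  have uminus_eq: "\<ominus>\<^bsub>complex_field\<^esub> a = - a" for a :: complex
    by (rule C.minus_equality) (simp_all add: ops)
  from x have "x \<in> generate_ring complex_field {\<theta>}"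
    by (simp add: int_adjoin_simps)
  thus ?thesis
  proof (induction rule: generate_ring.induct)
    case one
    show ?case using zero by (auto simp: ops intro!: exI[of _ 1])
  next
    case (incl h)
    thus ?case using \<theta> by auto
  next
    case (a_inv h)
    then obtain c where c: "algebraic_int h" "h - of_int c \<in> M" by blast
    have "- h - of_int (- c) \<in> M"
      using uminus[OF c(2)] by simp
    thus ?case
      unfolding uminus_eq using c(1) by (intro conjI exI[of _ "- c"] algebraic_int_minus)
  next
    case (eng_add h1 h2)
    then obtain c1 c2 where c: "algebraic_int h1" "h1 - of_int c1 \<in> M" "algebraic_int h2" "h2 - of_int c2 \<in> M"
      by blast
    have "h1 + h2 - of_int (c1 + c2) \<in> M"
      using add[OF c(2,4)] by (simp add: algebra_simps)
    thus ?case
      using algebraic_int_add[OF c(1,3)] by (auto simp: ops simp del: of_int_add)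
  next
    case (eng_mult h1 h2)
    then obtain c1 c2 where c: "algebraic_int h1" "h1 - of_int c1 \<in> M" "algebraic_int h2" "h2 - of_int c2 \<in> M"
      by blast
    have "(h1 - of_int c1) * h2 + of_int c1 * (h2 - of_int c2) \<in> M"
      by (rule add[OF mult_right[OF c(2,3)] mult_left[OF c(4) algebraic_int_of_int]])
    hence "h1 * h2 - of_int (c1 * c2) \<in> M"
      by (simp add: algebra_simps)
    thus ?case
      using algebraic_int_times[OF c(1,3)] by (auto simp: ops simp del: of_int_mult)
  qed
qed

text \<open>On \<int>[\<theta>] the map \<open>residue\<close> is a homomorphism onto the field with
  \<open>p\<close> elements. Its kernel is prime, contains \<open>p\<close>, and has index
  \<open>p\<close> by the isomorphism theorem.\<close>

lemma first_degree_prime_pairI: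
  assumes \<theta>: "algebraic_int \<theta>" "\<theta> - of_int r \<in> M" and r: "0 \<le> r" "r < int p"
  shows "first_degree_prime_pair \<theta> r p"
proof -
  have p: "p > 1"
    using prime_p by (rule prime_gt_1_nat)
  define R where "R = int_adjoin \<theta>"
  define S where "S = residue_ring (int p)"
  interpret R: cring R
    unfolding R_def by (rule cring_int_adjoin)
  interpret S: residues_prime p S
    unfolding S_def by unfold_locales (rule prime_p)
  have S_simps: "carrier S = {0..int p - 1}" "\<zero>\<^bsub>S\<^esub> = 0" "\<one>\<^bsub>S\<^esub> = 1"
    "a \<oplus>\<^bsub>S\<^esub> b = (a + b) mod int p" "a \<otimes>\<^bsub>S\<^esub> b = (a * b) mod int p" for a b
    by (simp_all add: S_def residue_ring_def)
  have residue: "algebraic_int x" "x - of_int (residue x) \<in> M" "residue x \<in> carrier S"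
    if x: "x \<in> carrier R" for x
  proof -
    obtain c where c: "algebraic_int x" "x - of_int c \<in> M"
      using int_adjoin_cong_int[OF \<theta>] x by (auto simp: R_def)
    have res: "residue x = c mod int p"
      by (rule residue_mod_eqI[OF c(2)])
    have "of_int (c - c mod int p) \<in> M"
      by (intro of_int_in) simp
    from add[OF c(2) this] show "x - of_int (residue x) \<in> M"
      by (simp add: res)
    show "algebraic_int x" by (rule c)
    show "residue x \<in> carrier S"
      using p by (simp add: res S_simps)
  qed
  have hom: "residue \<in> Ring.ring_hom R S"
  proof (rule ring_hom_memI)
    show "residue x \<in> carrier S" if "x \<in> carrier R" for x
      by (rule residue[OF that])
    show "residue \<one>\<^bsub>R\<^esub> = \<one>\<^bsub>S\<^esub>"
      using p zero by (auto simp: R_def int_adjoin_simps S_simps intro!: residue_eqI)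
    fix x y assume xy: "x \<in> carrier R" "y \<in> carrier R"
    have "(x - of_int (residue x)) + (y - of_int (residue y)) \<in> M"
      using xy by (intro add residue)
    thus "residue (x \<oplus>\<^bsub>R\<^esub> y) = residue x \<oplus>\<^bsub>S\<^esub> residue y"
      by (auto simp: R_def int_adjoin_simps S_simps algebra_simps intro!: residue_mod_eqI)
    have "(x - of_int (residue x)) * y + of_int (residue x) * (y - of_int (residue y)) \<in> M"
      by (rule add[OF mult_right[OF residue(2)[OF xy(1)] residue(1)[OF xy(2)]]
            mult_left[OF residue(2)[OF xy(2)] algebraic_int_of_int]])
    thus "residue (x \<otimes>\<^bsub>R\<^esub> y) = residue x \<otimes>\<^bsub>S\<^esub> residue y"
      by (auto simp: R_def int_adjoin_simps S_simps algebra_simps intro!: residue_mod_eqI)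
  qed
  have hom_ring: "ring_hom_ring R S residue"
    by (rule ring_hom_ringI2[OF R.ring_axioms S.ring_axioms hom])
  define P where "P = a_kernel R S residue"
  have P: "P = {x \<in> carrier R. residue x = 0}"
    by (simp add: P_def a_kernel_def' S_simps)
  have of_int_R: "of_int k \<in> carrier R" for k
    by (simp add: R_def of_int_in_int_adjoin)
  have "primeideal {x \<in> carrier R. residue x \<in> {\<zero>\<^bsub>S\<^esub>}} R"
    by (rule ring_hom_ring.primeideal_vimage[OF hom_ring R.is_cring S.zeroprimeideal])
  hence prime: "primeideal P R"
    by (simp add: P S_simps)
  have "residue (of_nat p) = 0"
    using p_in p by (intro residue_eqI) auto
  hence "of_nat p \<in> P"
    using of_int_R[of "int p"] by (simp add: P)
  hence nontrivial: "P \<noteq> {0}"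
    using p by auto
  have "residue ` carrier R = carrier S"
  proof
    show "residue ` carrier R \<subseteq> carrier S"
      using residue(3) by blast
    show "carrier S \<subseteq> residue ` carrier R"
    proof
      fix c assume "c \<in> carrier S"
      hence "residue (of_int c) = c"
        using zero by (intro residue_eqI) (auto simp: S_simps)
      thus "c \<in> residue ` carrier R"
        using of_int_R by (metis imageI)
    qed
  qed
  from ring_hom_ring.FactRing_iso_set[OF hom_ring this]
  have "bij_betw (\<lambda>C. the_elem (residue ` C)) (a_rcosets\<^bsub>R\<^esub> P) (carrier S)"
    by (simp add: ring_iso_def FactRing_def P_def)
  hence "card (a_rcosets\<^bsub>R\<^esub> P) = p"
    using bij_betw_same_card by (fastforce simp: S_simps)
  hence norm: "ideal_norm \<theta> P = p"
    by (simp add: ideal_norm_def R_def)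
  have "residue \<theta> = r"
    by (rule residue_eqI[OF r \<theta>(2)])
  hence "pair_denotes \<theta> r p P"
    using hom unfolding pair_denotes_def P_def R_def S_def by blast
  thus ?thesis
    using prime nontrivial prime_p norm
    unfolding first_degree_prime_pair_def first_degree_prime_ideal_def R_def by auto
qed

section \<open>Frobenius-fixed residues are integers\<close>

lemma ex_int_cong_if_enough_roots:
  assumes "lead_coeff P = 1" "algebraic_int x" "poly (map_poly of_int P) x \<in> M"
    and "finite A" "card A = Polynomial.degree P"
    and "\<And>a b. a \<in> A \<Longrightarrow> b \<in> A \<Longrightarrow> a \<noteq> b \<Longrightarrow> \<not> int p dvd a - b"
    and "\<And>a. a \<in> A \<Longrightarrow> int p dvd poly P a"
  shows "\<exists>a\<in>A. x - of_int a \<in> M"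
  using assms
proof (induction "Polynomial.degree P" arbitrary: P A)
  case 0
  then obtain c where "P = [:c:]"
    by (metis degree_eq_zeroE)
  thus ?case
    using 0 one_notin by simp
next
  case (Suc n)
  obtain a where a: "a \<in> A"
    using Suc.prems(5) Suc.hyps(2) by (metis card.empty ex_in_conv nat.distinct(1))
  define Q where "Q = synthetic_div P a"
  \<comment> \<open>Since P(a) lies in \<open>M\<close>, primality puts \<open>x - of_int a\<close>
    or Q(x) into \<open>M\<close>; in the latter case the other elements of \<open>A\<close> are
    roots of \<open>Q\<close> modulo \<open>p\<close>.\<close>
  have PQ: "P = [:- a, 1:] * Q + [:poly P a:]"
    using synthetic_div_correct'[of a P] by (simp add: Q_def)
  have deg: "Polynomial.degree Q = n"
    using Suc.hyps(2) by (simp add: Q_def degree_synthetic_div)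
  have "coeff P (Suc n) = lead_coeff Q"
    by (subst PQ) (simp add: deg coeff_eq_0)
  hence lead: "lead_coeff Q = 1"
    using Suc.prems(1) Suc.hyps(2) by simp
  have eval: "poly P y = (y - a) * poly Q y + poly P a" for y
    by (subst PQ) (simp add: algebra_simps)
  have "poly (map_poly of_int [:c:]) x = of_int c" for c
    by (cases "c = 0") simp_all
  hence "poly (map_poly of_int P) x = (x - of_int a) * poly (map_poly of_int Q) x + of_int (poly P a)"
    using arg_cong[OF PQ, of "\<lambda>R. poly (map_poly of_int R) x"]
    unfolding of_int_poly_hom.hom_add of_int_poly_hom.hom_mult poly_add poly_mult
    by (simp add: map_poly_pCons algebra_simps)
  moreover have "of_int (poly P a) \<in> M"
    using Suc.prems(7)[OF a] by (rule of_int_in)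
  ultimately have "(x - of_int a) * poly (map_poly of_int Q) x \<in> M"
    using diff[OF Suc.prems(3)] by (metis add_diff_cancel_right')
  hence "x - of_int a \<in> M \<or> poly (map_poly of_int Q) x \<in> M"
    using Suc.prems(2) by (intro prime algebraic_int_diff algebraic_int_poly_of_int) auto
  thus ?case
  proof
    assume "x - of_int a \<in> M"
    thus ?thesis using a by blast
  next
    assume Qx: "poly (map_poly of_int Q) x \<in> M"
    have "\<exists>b\<in>A - {a}. x - of_int b \<in> M"
    proof (rule Suc.hyps(1)[OF deg[symmetric] lead Suc.prems(2) Qx])
      show "card (A - {a}) = Polynomial.degree Q"
        using Suc.prems(4,5) Suc.hyps(2) a by (simp add: deg)
      show "int p dvd poly Q b" if b: "b \<in> A - {a}" for b
      proof -
        have "int p dvd (b - a) * poly Q b"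
          using Suc.prems(7)[of b] Suc.prems(7)[OF a] b eval[of b]
          by (metis Diff_iff dvd_add_left_iff)
        thus ?thesis
          using Suc.prems(6)[of b a] a b prime_p by (auto simp: prime_dvd_mult_iff)
      qed
    qed (use Suc.prems in auto)
    thus ?thesis by blast
  qed
qed

text \<open>By Fermat's little theorem X^p - X has all \<open>p\<close> residues as roots modulo
  \<open>p\<close>, so a root modulo \<open>M\<close> is congruent to one of them.\<close>

lemma ex_int_cong_if_frobenius_fixed:
  assumes x: "algebraic_int x" "x ^ p - x \<in> M"
  shows "\<exists>s. 0 \<le> s \<and> s < int p \<and> x - of_int s \<in> M"
proof -
  have p: "p > 1"
    using prime_p by (rule prime_gt_1_nat)
  define P :: "int poly" where "P = Polynomial.monom 1 p + [:0, -1:]"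
  have deg: "Polynomial.degree P = p"
    using p by (simp add: P_def degree_add_eq_left degree_monom_eq)
  have "\<exists>a\<in>{0..<int p}. x - of_int a \<in> M"
  proof (rule ex_int_cong_if_enough_roots[of P])
    show "lead_coeff P = 1"
      unfolding deg using p by (simp add: P_def coeff_eq_0)
    show "poly (map_poly of_int P) x \<in> M"
      using x(2) by (simp add: P_def of_int_poly_hom.hom_add poly_monom map_poly_pCons)
    show "int p dvd poly P a" for a
      using frob_of_int[of a] of_int_in_iff[of "a ^ p - a"] by (simp add: frob_def P_def poly_monom)
    show "\<not> int p dvd a - b" if "a \<in> {0..<int p}" "b \<in> {0..<int p}" "a \<noteq> b" for a b
      using that by (auto simp flip: mod_eq_dvd_iff)
  qed (use x deg in auto)
  thus ?thesis by auto
qed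

lemma power_prime_power_add:
  assumes x: "algebraic_int x" and y: "algebraic_int y"
  shows "(x + y) ^ (p ^ k) - (x ^ (p ^ k) + y ^ (p ^ k)) \<in> M"
proof (induction k)
  case 0
  show ?case by (simp add: zero)
next
  case (Suc k)
  have "(((x + y) ^ (p ^ k)) ^ p - (x ^ (p ^ k) + y ^ (p ^ k)) ^ p)
      + ((x ^ (p ^ k) + y ^ (p ^ k)) ^ p - ((x ^ (p ^ k)) ^ p + (y ^ (p ^ k)) ^ p)) \<in> M"
    using x y Suc
    by (intro add power_cong power_prime_add) (auto intro!: algebraic_int_power algebraic_int_add)
  thus ?case
    by (simp add: algebra_simps flip: power_mult)
qed

lemma power_prime_power_fixed_iterate:
  assumes x: "algebraic_int x" "x ^ (p ^ k) - x \<in> M"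
  shows "x ^ (p ^ (k * n)) - x \<in> M"
proof (induction n)
  case 0
  show ?case by (simp add: zero)
next
  case (Suc n)
  have "((x ^ (p ^ (k * n))) ^ (p ^ k) - x ^ (p ^ k)) + (x ^ (p ^ k) - x) \<in> M"
    using x Suc by (intro add power_cong) (auto intro!: algebraic_int_power)
  thus ?case
    by (simp add: power_add mult.commute flip: power_mult)
qed

lemma of_int_power_prime_power: "of_int t ^ (p ^ k) - of_int t \<in> M"
  using power_prime_power_fixed_iterate[of "of_int t" 1 k] frob_of_int[of t] by (simp add: frob_def)

text \<open>
  As \<open>\<beta> \<equiv> t - \<alpha>\<close>, the length of the Frobenius orbit of \<open>\<beta>\<close> modulo \<open>M\<close> divides both \<open>m\<close> and \<open>n\<close>.
\<close>

lemma ex_int_cong_if_coprime_orbits: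
  assumes \<alpha>: "algebraic_int \<alpha>" and \<beta>: "algebraic_int \<beta>" and sum: "\<alpha> + \<beta> - of_int t \<in> M"
    and m: "\<alpha> ^ (p ^ m) - \<alpha> \<in> M" and n: "\<beta> ^ (p ^ n) - \<beta> \<in> M"
    and "Rings.coprime m n" "m > 0"
  shows "\<exists>s. 0 \<le> s \<and> s < int p \<and> \<beta> - of_int s \<in> M"
proof -
  \<comment> \<open>The combination collapses to \<open>\<beta> ^ (p ^ m) - \<beta>\<close>: the
    power of \<alpha> + \<beta> is congruent to t, hence to \<alpha> + \<beta>, and the contribution
    of \<alpha> cancels.\<close>
  have "((\<alpha> + \<beta>) ^ (p ^ m) - of_int t ^ (p ^ m)) + (of_int t ^ (p ^ m) - of_int t)
      - ((\<alpha> + \<beta>) ^ (p ^ m) - (\<alpha> ^ (p ^ m) + \<beta> ^ (p ^ m))) - (\<alpha> ^ (p ^ m) - \<alpha>)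
      - (\<alpha> + \<beta> - of_int t) \<in> M"
    by (intro diff[OF diff[OF diff]] add power_cong power_prime_power_add of_int_power_prime_power
        m sum \<alpha> \<beta> algebraic_int_add algebraic_int_of_int)
  hence "\<beta> ^ (p ^ m) - \<beta> \<in> M"
    by (simp add: algebra_simps)
  note m' = power_prime_power_fixed_iterate[OF \<beta> this]
  \<comment> \<open>With this form of Bezout's identity, \<open>m * u\<close> Frobenius steps are
    \<open>n * v\<close> steps and one more, so that single step fixes \<beta>.\<close>
  obtain u v where uv: "m * u = n * v + 1"
    using bezout_nat[of m n] \<open>m > 0\<close> \<open>Rings.coprime m n\<close> by auto
  have "(\<beta> ^ (p ^ (m * u)) - \<beta>) - ((\<beta> ^ (p ^ (n * v))) ^ p - \<beta> ^ p) \<in> M"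
    by (intro diff[OF m'] power_cong power_prime_power_fixed_iterate \<beta> n algebraic_int_power)
  hence "\<beta> ^ p - \<beta> \<in> M"
    by (simp add: uv mult.commute flip: power_mult)
  thus ?thesis
    by (rule ex_int_cong_if_frobenius_fixed[OF \<beta>])
qed

end

text \<open>The root \<alpha> of \<open>f\<close> lies in \<rat>(\<alpha>), so by normality
  \<open>f\<close> splits there, and elements of \<rat>(\<alpha>) are polynomials in
  \<alpha>.\<close>

lemma normal_conjugatesI:
  assumes "lead_coeff f = 1" "Factorial_Ring.irreducible f" "poly (map_poly of_int f) \<alpha> = 0"
    and "normal_over_rat (rat_adjoin \<alpha>)"
  shows "normal_conjugates f \<alpha>"
proof
  show irred: "Factorial_Ring.irreducible (map_poly rat_of_int f)"
    using assms(1,2) by (rule irreducible_of_int_poly)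
  fix a :: complex assume a: "poly (map_poly of_int f) a = 0"
  have root: "rpoly (map_poly rat_of_int f) \<alpha> = 0"
    using assms(3) by (simp add: rpoly_of_int_poly)
  moreover have "\<alpha> \<in> rat_adjoin \<alpha>"
    by (simp add: rat_adjoin_def generate_field.incl)
  ultimately have "splits_over (rat_adjoin \<alpha>) (map_poly rat_of_int f)"
    using assms(4) irred unfolding normal_over_rat_def by blast
  hence "a \<in> rat_adjoin \<alpha>"
    by (rule splits_over_root_mem) (use irred a in \<open>auto simp: rpoly_of_int_poly\<close>)
  thus "\<exists>Q. a = rpoly Q \<alpha>"
    by (rule rat_adjoin_eq_rpoly[OF irred root])
qed (use assms in auto)

theorem proposition3p10:
  fixes f g :: "int poly" and \<alpha> \<beta> :: complex and t :: int and p :: nat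
  assumes "lead_coeff f = 1" and "Factorial_Ring.irreducible f"
    and "lead_coeff g = 1" and "Factorial_Ring.irreducible g"
    and "coprime (Polynomial.degree f) (Polynomial.degree g)"
    and "poly (map_poly of_int f) \<alpha> = 0" and "poly (map_poly of_int g) \<beta> = 0"
    and "normal_over_rat (rat_adjoin \<alpha>)" and "normal_over_rat (rat_adjoin \<beta>)"
    and "first_degree_prime_pair (\<alpha> + \<beta>) t p"
  shows "\<exists>r s. first_degree_prime_pair \<alpha> r p \<and> first_degree_prime_pair \<beta> s p \<and>
           t = r \<oplus>\<^bsub>residue_ring (int p)\<^esub> s"
proof -
  note t = first_degree_prime_pairD[OF assms(10)]
  interpret F: normal_conjugates f \<alpha>
    using assms by (intro normal_conjugatesI)
  interpret G: normal_conjugates g \<beta>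
    using assms by (intro normal_conjugatesI)
  have \<alpha>: "algebraic_int \<alpha>" and \<beta>: "algebraic_int \<beta>"
    using F.algebraic_int_conjs[OF F.gen_in_conjs] G.algebraic_int_conjs[OF G.gen_in_conjs] .
  \<comment> \<open>Composition with X - t moves the root to \<alpha> + \<beta>, and the value at
    \<open>t\<close> of the composite is P(0).\<close>
  have "int p dvd poly P 0" if "poly (map_poly of_int P) (\<alpha> + \<beta> - of_int t) = 0" for P
    using t(4)[of "P \<circ>\<^sub>p [:- t, 1:]"] that
    by (simp add: of_int_hom.map_poly_pcompose poly_pcompose map_poly_pCons)
  moreover have "algebraic_int (\<alpha> + \<beta> - of_int t)"
    using \<alpha> \<beta> by (intro algebraic_int_diff algebraic_int_add algebraic_int_of_int)
  ultimately obtain M where M: "alg_int_prime M" "of_nat p \<in> M" "\<alpha> + \<beta> - of_int t \<in> M"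
    using ex_alg_int_prime_lying_over[OF prime_gt_1_nat[OF t(1)]] by blast
  interpret M: alg_int_prime M
    by (rule M)
  interpret M: alg_int_prime_over M p
    by unfold_locales (use t M in auto)
  \<comment> \<open>One prime \<open>M\<close> serves both polynomials, so the two Frobenius
    relations can be combined.\<close>
  interpret FM: normal_mod_prime f \<alpha> M p ..
  interpret GM: normal_mod_prime g \<beta> M p ..
  obtain s where s: "0 \<le> s" "s < int p" "\<beta> - of_int s \<in> M"
    using M.ex_int_cong_if_coprime_orbits[OF \<alpha> \<beta> M(3) FM.frobenius_power_degree
        GM.frobenius_power_degree assms(5) F.degree_pos] by blast
  \<comment> \<open>The value forced by t = r + s; \<alpha> is congruent to it because \<alpha> +
    \<beta> \<equiv> t and \<beta> \<equiv> s.\<close>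
  define r where "r = (t - s) mod int p"
  have "(\<alpha> + \<beta> - of_int t) - (\<beta> - of_int s) + of_int (t - s - r) \<in> M"
    by (intro M.add M.diff[of "_ - _" "_ - _"] M.of_int_in M(3) s) (simp add: r_def)
  hence r: "\<alpha> - of_int r \<in> M"
    by simp
  have "first_degree_prime_pair \<alpha> r p" "first_degree_prime_pair \<beta> s p"
    using prime_gt_0_nat[OF t(1)] s r \<alpha> \<beta> by (auto intro!: M.first_degree_prime_pairI simp: r_def)
  moreover have "t = r \<oplus>\<^bsub>residue_ring (int p)\<^esub> s"
    using t by (simp add: residue_ring_def r_def mod_simps)
  ultimately show ?thesis
    by blast
qed

end
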